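(* Suppose that $s\neq 0$ and $a\neq 0$. Then the following statements are equivalent: 1. The algebra $\mathcal{E}=(E,\sigma,a)$ is a division algebra. 2. The algebra $E(s)=F[h]/(h^n-s)$ is a field and $n=\min\{d'\ge1\mid d'\mid n$ and there is a matrix $\mathbb{X}\in M_{d'}(E(s))$ such that $\mathbb{X}^{\sigma^{n-1}}\cdots\mathbb{X}^\sigma\mathbb{X}=a\}$. 3. The algebra $E(a)=F[x]/(x^n-a)$ is a field and $n=\min\{d'\ge1\mid d'\mid n$ and there is a matrix $\mathbb{Y}\in M_{d'}(E(a))$ such that $\mathbb{Y}^{\tau^{n-1}}\cdots\mathbb{Y}^\tau\mathbb{Y}=s\}$.
   Context: $F$ is a field containing a primitive $n$'th root of unity $q$ ($n\ge2$), $s,a\in F$, and $\mathcal{E}=(E,\sigma,a)$, $E=E(s)$, is the $F$-algebra generated by $h,x$ with relations $xh=qhx$, $h^n=s$, $x^n=a$. $\sigma$ is the $F$-automorphism of $E(s)$ with $\sigma(h)=qh$ and $\tau$ is the $F$-automorphism of $E(a)$ with $\tau(x)=q^{-1}x$. For a matrix $\mathbb{Y}=(y_{ij})$ and an automorphism $\rho$, $\mathbb{Y}^{\rho}=(\rho(y_{ij}))$. In matrix equations $a$ and $s$ stand for the corresponding scalar matrices. *)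

theory Defs
  imports
    "HOL-Algebra.Algebra"
    "HOL-Algebra.Algebraic_Closure_Type"
    "HOL-Computational_Algebra.Polynomial"
    "HOL-Library.Poly_Mapping"
    "Jordan_Normal_Form.Matrix"
begin

definition primitive_nth_root :: "nat \<Rightarrow> 'a::field \<Rightarrow> bool" where
  "primitive_nth_root n q \<longleftrightarrow> q ^ n = 1 \<and> (\<forall>k. 0 < k \<and> k < n \<longrightarrow> q ^ k \<noteq> 1)"

definition is_division_ring :: "('b, 'm) ring_scheme \<Rightarrow> bool" where
  "is_division_ring R \<longleftrightarrow> ring R \<and> \<one>\<^bsub>R\<^esub> \<noteq> \<zero>\<^bsub>R\<^esub> \<and> Units R = carrier R - {\<zero>\<^bsub>R\<^esub>}"


subsection \<open>The commutative algebra \<open>F[X]/(X^n - c)\<close>\<close>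

definition radical_ideal :: "nat \<Rightarrow> 'a::field \<Rightarrow> 'a poly set" where
  "radical_ideal n c = PIdl\<^bsub>ring_of_type_algebra\<^esub> (monom 1 n - [:c:])"

definition radical_alg :: "nat \<Rightarrow> 'a::field \<Rightarrow> 'a poly set ring" where
  "radical_alg n c = ring_of_type_algebra Quot radical_ideal n c"

definition radical_class :: "nat \<Rightarrow> 'a::field \<Rightarrow> 'a poly \<Rightarrow> 'a poly set" where
  "radical_class n c p = radical_ideal n c +>\<^bsub>ring_of_type_algebra\<^esub> p"

abbreviation radical_gen :: "nat \<Rightarrow> 'a::field \<Rightarrow> 'a poly set" where
  "radical_gen n c \<equiv> radical_class n c [:0, 1:]"

abbreviation radical_scalar :: "nat \<Rightarrow> 'a::field \<Rightarrow> 'a \<Rightarrow> 'a poly set" where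
  "radical_scalar n c u \<equiv> radical_class n c [:u:]"

text \<open>
  The \<open>F\<close>-automorphisms of \<open>F[X]/(X^n - c)\<close>. As usual for functions between carriers, values
  outside the carrier are irrelevant.
\<close>

definition radical_automorphism :: "nat \<Rightarrow> 'a::field \<Rightarrow> ('a poly set \<Rightarrow> 'a poly set) \<Rightarrow> bool" where
  "radical_automorphism n c \<rho> \<longleftrightarrow>
     \<rho> \<in> ring_iso (radical_alg n c) (radical_alg n c) \<and>
     (\<forall>u. \<rho> (radical_scalar n c u) = radical_scalar n c u)"


subsection \<open>The algebra generated by \<open>h\<close> and \<open>x\<close> with \<open>xh = qhx\<close>, \<open>h^n = s\<close>, \<open>x^n = a\<close>\<close>

datatype generator = Gen_h | Gen_x

text \<open>
  Words in the generators under concatenation, written additively so that the convolution product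
  of \<^typ>\<open>_ \<Rightarrow>\<^sub>0 _\<close> makes \<open>free_word \<Rightarrow>\<^sub>0 'a\<close> the free associative algebra \<open>F\<langle>h,x\<rangle>\<close>.
\<close>

datatype free_word = Word "generator list"

instantiation free_word :: monoid_add
begin

definition zero_free_word :: free_word where
  "0 = Word []"

fun plus_free_word :: "free_word \<Rightarrow> free_word \<Rightarrow> free_word" where
  "Word u + Word v = Word (u @ v)"

instance
proof
  fix u v w :: free_word
  show "u + v + w = u + (v + w)" by (cases u; cases v; cases w) simp
  show "0 + u = u" by (cases u) (simp add: zero_free_word_def)
  show "u + 0 = u" by (cases u) (simp add: zero_free_word_def)
qed

end

type_synonym 'a free_alg = "free_word \<Rightarrow>\<^sub>0 'a"

definition free_scalar :: "'a::field \<Rightarrow> 'a free_alg" where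
  "free_scalar c = Poly_Mapping.single 0 c"

definition free_gen :: "generator \<Rightarrow> 'a::field free_alg" where
  "free_gen g = Poly_Mapping.single (Word [g]) 1"

definition symbol_relations :: "nat \<Rightarrow> 'a::field \<Rightarrow> 'a \<Rightarrow> 'a \<Rightarrow> 'a free_alg set" where
  "symbol_relations n q s a =
     (let h = free_gen Gen_h; x = free_gen Gen_x in
       {x * h - free_scalar q * h * x, h ^ n - free_scalar s, x ^ n - free_scalar a})"

text \<open>\<^const>\<open>genideal\<close> is the generated two-sided ideal.\<close>

definition symbol_alg :: "nat \<Rightarrow> 'a::field \<Rightarrow> 'a \<Rightarrow> 'a \<Rightarrow> 'a free_alg set ring" where
  "symbol_alg n q s a =
     ring_of_type_algebra Quot (Idl\<^bsub>ring_of_type_algebra\<^esub> (symbol_relations n q s a))"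


subsection \<open>Matrices over a ring with explicit carrier\<close>

text \<open>
  The type of matrices serves as a container only: its arithmetic uses the type class operations
  of the entries, whereas here the entries are multiplied and added in the ring \<open>R\<close>.
\<close>

definition ring_matrices :: "('b, 'm) ring_scheme \<Rightarrow> nat \<Rightarrow> 'b mat set" where
  "ring_matrices R d = {M \<in> carrier_mat d d. elements_mat M \<subseteq> carrier R}"

definition matrix_mult :: "('b, 'm) ring_scheme \<Rightarrow> 'b mat \<Rightarrow> 'b mat \<Rightarrow> 'b mat" where
  "matrix_mult R M N = mat (dim_row M) (dim_col N)
     (\<lambda>(i, j). \<Oplus>\<^bsub>R\<^esub>k\<in>{..<dim_col M}. M $$ (i, k) \<otimes>\<^bsub>R\<^esub> N $$ (k, j))"

definition scalar_matrix :: "('b, 'm) ring_scheme \<Rightarrow> nat \<Rightarrow> 'b \<Rightarrow> 'b mat" where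
  "scalar_matrix R d c = mat d d (\<lambda>(i, j). if i = j then c else \<zero>\<^bsub>R\<^esub>)"

text \<open>
  With \<open>M(i)\<close> the matrix \<open>M\<close> with \<open>\<rho> ^^ i\<close> applied to its entries, this is the product
  \<open>M(k - 1) \<cdots> M(1) M(0)\<close> in this order.
\<close>

primrec twisted_power ::
  "('b, 'm) ring_scheme \<Rightarrow> nat \<Rightarrow> ('b \<Rightarrow> 'b) \<Rightarrow> 'b mat \<Rightarrow> nat \<Rightarrow> 'b mat" where
  "twisted_power R d \<rho> M 0 = scalar_matrix R d \<one>\<^bsub>R\<^esub>"
| "twisted_power R d \<rho> M (Suc k) =
     matrix_mult R (map_mat (\<rho> ^^ k) M) (twisted_power R d \<rho> M k)"

end

theory Submission
  imports Defs
begin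

text \<open>
  A \<open>d \<times> d\<close> matrix over \<open>E(s)\<close> whose twisted \<open>n\<close>-th power is \<open>a\<close> is the same thing as a left module
  over the symbol algebra \<open>A\<close> of dimension \<open>d\<close> over \<open>E(s)\<close>: \<open>h\<close> acts on row vectors as a scalar
  and \<open>x\<close> acts by \<open>v \<mapsto> \<sigma>(v) M\<close>. The companion matrix realises \<open>d = n\<close> and shows that
  \<open>1, x, \<dots>, x^(n-1)\<close> are independent over \<open>E(s)\<close>. If \<open>A\<close> is a division algebra, a module with
  \<open>d < n\<close> is impossible, since \<open>n\<close> vectors \<open>x^j v\<close> in dimension \<open>d\<close> satisfy a linear relation,
  which is an element of \<open>A\<close> killing \<open>v \<noteq> 0\<close>. Conversely, if \<open>E(s)\<close> is a field then \<open>A\<close> is simple,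
  and if \<open>A\<close> is not a division algebra a minimal left ideal is a module whose dimension is a
  proper divisor of \<open>n\<close>. Exchanging \<open>h\<close> and \<open>x\<close> replaces \<open>(q, s, a)\<close> by \<open>(q\<inverse>, a, s)\<close>.
\<close>

section \<open>Quotients of rings given by type classes\<close>

lemma ring_of_type_algebra_sel [simp]:
  "carrier ring_of_type_algebra = UNIV"
  "x \<otimes>\<^bsub>ring_of_type_algebra\<^esub> y = x * y"
  "\<one>\<^bsub>ring_of_type_algebra\<^esub> = 1"
  "\<zero>\<^bsub>ring_of_type_algebra\<^esub> = 0"
  "x \<oplus>\<^bsub>ring_of_type_algebra\<^esub> y = x + y"
  by (simp_all add: ring_of_type_algebra_def)

lemma ring_ring_of_type_algebra: "ring (ring_of_type_algebra :: 'b::ring_1 ring)"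
proof -
  have "\<exists>y. x + y = 0" for x :: 'b
    using add.right_inverse by blast
  then show ?thesis
    unfolding ring_of_type_algebra_def using add.right_inverse
    by unfold_locales (auto simp: algebra_simps Units_def)
qed

lemma ring_of_type_algebra_minus [simp]:
  "x \<ominus>\<^bsub>ring_of_type_algebra\<^esub> y = x - (y :: 'b::ring_1)"
proof -
  interpret ring "ring_of_type_algebra :: 'b ring"
    by (rule ring_ring_of_type_algebra)
  have "\<ominus>\<^bsub>ring_of_type_algebra\<^esub> y = - y"
    by (rule minus_equality) simp_all
  then show ?thesis
    by (simp add: a_minus_def)
qed

lemma ideal_ring_of_type_algebraI:
  fixes I :: "'b::ring_1 set"
  assumes "0 \<in> I" "\<And>f g. f \<in> I \<Longrightarrow> g \<in> I \<Longrightarrow> f + g \<in> I"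
    and "\<And>f g. f \<in> I \<Longrightarrow> g * f \<in> I" "\<And>f g. f \<in> I \<Longrightarrow> f * g \<in> I"
  shows "ideal I ring_of_type_algebra"
proof (rule idealI)
  show "ring (ring_of_type_algebra :: 'b ring)"
    by (rule ring_ring_of_type_algebra)
  then interpret ring "ring_of_type_algebra :: 'b ring" .
  show "subgroup I (add_monoid ring_of_type_algebra)"
  proof
    fix x :: 'b assume "x \<in> I"
    have "inv\<^bsub>add_monoid ring_of_type_algebra\<^esub> x = - x"
      unfolding a_inv_def[symmetric] by (rule minus_equality) simp_all
    with assms(3)[OF \<open>x \<in> I\<close>, of "- 1"] show "inv\<^bsub>add_monoid ring_of_type_algebra\<^esub> x \<in> I"
      by simp
  qed (use assms in auto)
qed (use assms in auto)

text \<open>The quotient is handled through representatives: equations in it become congruences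
  modulo \<open>J\<close>, which can be chained and rewritten like type class terms.\<close>

locale type_ideal = ideal J "ring_of_type_algebra :: 'b::ring_1 ring" for J :: "'b::ring_1 set"
begin

abbreviation quo :: "'b set ring"
  where "quo \<equiv> ring_of_type_algebra Quot J"

definition cls :: "'b \<Rightarrow> 'b set"
  where "cls f = J +>\<^bsub>ring_of_type_algebra\<^esub> f"

definition cong_mod :: "'b \<Rightarrow> 'b \<Rightarrow> bool" (infix \<open>\<doteq>\<close> 50)
  where "f \<doteq> g \<longleftrightarrow> f - g \<in> J"

lemma zero_mem: "0 \<in> J"
  using additive_subgroup.zero_closed[OF is_additive_subgroup] by simp

lemma add_mem: "f \<in> J \<Longrightarrow> g \<in> J \<Longrightarrow> f + g \<in> J"
  using additive_subgroup.a_closed[OF is_additive_subgroup] by simp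

lemma mult_left_mem: "f \<in> J \<Longrightarrow> g * f \<in> J"
  using I_l_closed by simp

lemma mult_right_mem: "f \<in> J \<Longrightarrow> f * g \<in> J"
  using I_r_closed by simp

lemma uminus_mem: "f \<in> J \<Longrightarrow> - f \<in> J"
  using mult_left_mem[of f "- 1"] by simp

lemma diff_mem: "f \<in> J \<Longrightarrow> g \<in> J \<Longrightarrow> f - g \<in> J"
  using add_mem[of f "- g"] uminus_mem[of g] by simp

lemma cong_refl [simp, intro]: "f \<doteq> f"
  by (simp add: cong_mod_def zero_mem)

lemma cong_sym: "f \<doteq> g \<Longrightarrow> g \<doteq> f"
  unfolding cong_mod_def using uminus_mem[of "f - g"] by simp

lemma cong_trans [trans]: "f \<doteq> g \<Longrightarrow> g \<doteq> k \<Longrightarrow> f \<doteq> k"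
  unfolding cong_mod_def using add_mem[of "f - g" "g - k"] by simp

lemma cong_add: "f \<doteq> f' \<Longrightarrow> g \<doteq> g' \<Longrightarrow> f + g \<doteq> f' + g'"
  unfolding cong_mod_def using add_mem[of "f - f'" "g - g'"] by (simp add: algebra_simps)

lemma cong_diff: "f \<doteq> f' \<Longrightarrow> g \<doteq> g' \<Longrightarrow> f - g \<doteq> f' - g'"
  unfolding cong_mod_def using add_mem[of "f - f'" "- (g - g')"] uminus_mem[of "g - g'"]
  by (simp add: algebra_simps)

lemma cong_mult: "f \<doteq> f' \<Longrightarrow> g \<doteq> g' \<Longrightarrow> f * g \<doteq> f' * g'"
  unfolding cong_mod_def
  using add_mem[OF mult_right_mem[of "f - f'" g] mult_left_mem[of "g - g'" f']]
  by (simp add: algebra_simps)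

lemma cong_sum: "(\<And>i. i \<in> A \<Longrightarrow> f i \<doteq> g i) \<Longrightarrow> sum f A \<doteq> sum g A"
  by (induction A rule: infinite_finite_induct) (auto intro: cong_add)

lemma cong_0_iff: "f \<doteq> 0 \<longleftrightarrow> f \<in> J"
  by (simp add: cong_mod_def)

lemma cong_mem: "f \<doteq> g \<Longrightarrow> f \<in> J \<longleftrightarrow> g \<in> J"
  using cong_sym cong_trans cong_0_iff by blast

lemma cls_eq_iff: "cls f = cls g \<longleftrightarrow> f \<doteq> g"
  unfolding cls_def cong_mod_def
  using quotient_eq_iff_same_a_r_cos[OF ideal_axioms, of f g] by simp

lemma carrier_quo: "carrier quo = range cls"
  by (auto simp: FactRing_def A_RCOSETS_defs a_r_coset_defs cls_def)

lemma cls_carrier [simp]: "cls f \<in> carrier quo"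
  by (simp add: carrier_quo)

lemma carrier_quoE: "u \<in> carrier quo \<Longrightarrow> (\<And>f. u = cls f \<Longrightarrow> thesis) \<Longrightarrow> thesis"
  by (auto simp: carrier_quo)

lemma cls_mult: "cls f \<otimes>\<^bsub>quo\<^esub> cls g = cls (f * g)"
  using ring_hom_mult[OF rcos_ring_hom, of f g] by (simp add: cls_def)

lemma cls_add: "cls f \<oplus>\<^bsub>quo\<^esub> cls g = cls (f + g)"
  using ring_hom_add[OF rcos_ring_hom, of f g] by (simp add: cls_def)

lemma cls_1: "\<one>\<^bsub>quo\<^esub> = cls 1"
  using ring_hom_one[OF rcos_ring_hom] by (simp add: cls_def)

lemma cls_0: "\<zero>\<^bsub>quo\<^esub> = cls 0"
  using ring_hom_zero[OF rcos_ring_hom ring_ring_of_type_algebra quotient_is_ring]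
  by (simp add: cls_def)

lemma cls_sum: "cls (\<Sum>i\<in>A. f i) = (\<Oplus>\<^bsub>quo\<^esub>i\<in>A. cls (f i))" if "finite A"
proof -
  interpret Q: ring quo by (rule quotient_is_ring)
  show ?thesis
    using that by (induction A) (simp_all add: cls_0 flip: cls_add)
qed

lemma cls_mem_zero_iff: "cls f = \<zero>\<^bsub>quo\<^esub> \<longleftrightarrow> f \<in> J"
  by (simp add: cls_0 cls_eq_iff cong_0_iff)

text \<open>Left inverses suffice: if \<open>g * f\<close> is 1, then \<open>g\<close> is nonzero
  and has a left inverse \<open>k\<close>, and \<open>k\<close> agrees with
  \<open>k * g * f\<close>, hence with \<open>f\<close>. So \<open>g\<close> is also a right
  inverse.\<close>

lemma is_division_ring_quo_iff:
  "is_division_ring quo \<longleftrightarrow> 1 \<notin> J \<and> (\<forall>f. f \<notin> J \<longrightarrow> (\<exists>g. g * f \<doteq> 1))"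
proof -
  interpret Q: ring quo by (rule quotient_is_ring)
  have "Units quo = carrier quo - {\<zero>\<^bsub>quo\<^esub>} \<longleftrightarrow> (\<forall>f. f \<notin> J \<longrightarrow> (\<exists>g. g * f \<doteq> 1))"
    if "1 \<notin> J"
  proof
    assume U: "Units quo = carrier quo - {\<zero>\<^bsub>quo\<^esub>}"
    show "\<forall>f. f \<notin> J \<longrightarrow> (\<exists>g. g * f \<doteq> 1)"
    proof (intro allI impI)
      fix f assume "f \<notin> J"
      with U have "cls f \<in> Units quo"
        by (simp add: cls_mem_zero_iff)
      then have "inv\<^bsub>quo\<^esub> cls f \<otimes>\<^bsub>quo\<^esub> cls f = \<one>\<^bsub>quo\<^esub>" "inv\<^bsub>quo\<^esub> cls f \<in> carrier quo"
        by (rule Q.Units_l_inv, rule Q.Units_inv_closed)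
      then show "\<exists>g. g * f \<doteq> 1"
        by (elim carrier_quoE) (auto simp: cls_mult cls_1 cls_eq_iff)
    qed
  next
    assume inv: "\<forall>f. f \<notin> J \<longrightarrow> (\<exists>g. g * f \<doteq> 1)"
    show "Units quo = carrier quo - {\<zero>\<^bsub>quo\<^esub>}"
    proof (intro subset_antisym subsetI)
      fix u assume u: "u \<in> Units quo"
      have "\<one>\<^bsub>quo\<^esub> \<noteq> \<zero>\<^bsub>quo\<^esub>"
        using that by (simp add: cls_1 cls_mem_zero_iff)
      then have "u \<noteq> \<zero>\<^bsub>quo\<^esub>"
        using Q.Units_l_inv[OF u] Q.r_null[OF Q.Units_inv_closed[OF u]] by auto
      with u show "u \<in> carrier quo - {\<zero>\<^bsub>quo\<^esub>}"
        using Q.Units_closed by blast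
    next
      fix u assume u: "u \<in> carrier quo - {\<zero>\<^bsub>quo\<^esub>}"
      then obtain f where f: "u = cls f"
        by (elim DiffE carrier_quoE)
      with u have "f \<notin> J"
        by (simp add: cls_mem_zero_iff)
      with inv obtain g where g: "g * f \<doteq> 1"
        by blast
      have "g \<notin> J"
        using g mult_right_mem[of g f] cong_mem that by blast
      with inv obtain k where k: "k * g \<doteq> 1"
        by blast
      have "f \<doteq> k * g * f"
        using cong_mult[OF k cong_refl[of f]] cong_sym by simp
      also have "k * g * f \<doteq> k"
        using cong_mult[OF cong_refl[of k] g] by (simp add: mult.assoc)
      finally have "f * g \<doteq> 1"
        using cong_mult[of f k g g] k cong_trans by blast
      with g have "cls g \<otimes>\<^bsub>quo\<^esub> cls f = \<one>\<^bsub>quo\<^esub>" "cls f \<otimes>\<^bsub>quo\<^esub> cls g = \<one>\<^bsub>quo\<^esub>"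
        by (simp_all add: cls_mult cls_1 cls_eq_iff)
      then show "u \<in> Units quo"
        unfolding Units_def f using cls_carrier by blast
    qed
  qed
  moreover have "\<one>\<^bsub>quo\<^esub> \<noteq> \<zero>\<^bsub>quo\<^esub> \<longleftrightarrow> 1 \<notin> J"
    by (simp add: cls_1 cls_mem_zero_iff)
  ultimately show ?thesis
    unfolding is_division_ring_def using Q.ring_axioms by auto
qed

end

lemma (in cring) field_iff_is_division_ring: "field R \<longleftrightarrow> is_division_ring R"
proof
  assume "field R"
  then interpret F: field R .
  show "is_division_ring R"
    unfolding is_division_ring_def using F.field_Units by (simp add: ring_axioms)
next
  assume "is_division_ring R"
  then show "field R"
    unfolding is_division_ring_def by (intro cring_fieldI) auto
qed

section \<open>Left ideals of simple rings\<close>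

context ring
begin

text \<open>Left ideals are encoded as \<open>subalgebra (carrier R) V R\<close>. Restricting the
  scalars to a subfield \<open>K\<close> then makes the dimension theory of
  \<open>K\<close>-subspaces available.\<close>

lemma left_ideal_mult_closed:
  "subalgebra (carrier R) V R \<Longrightarrow> r \<in> carrier R \<Longrightarrow> v \<in> V \<Longrightarrow> r \<otimes> v \<in> V"
  unfolding subalgebra_def subalgebra_axioms_def by blast

lemma left_ideal_subalgebra:
  "subalgebra (carrier R) V R \<Longrightarrow> K \<subseteq> carrier R \<Longrightarrow> subalgebra K V R"
  unfolding subalgebra_def subalgebra_axioms_def by blast

lemma left_ideal_sum:
  assumes V: "subalgebra (carrier R) V R" and W: "subalgebra (carrier R) W R"
  shows "subalgebra (carrier R) (V <+>\<^bsub>R\<^esub> W) R"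
proof -
  have sub: "V \<subseteq> carrier R" "W \<subseteq> carrier R"
    using assms subalgebra_in_carrier by auto
  have "subgroup (V <+>\<^bsub>R\<^esub> W) (add_monoid R)"
    using add.mult_subgroups V W unfolding subalgebra_def set_add_def by blast
  moreover have "r \<otimes> u \<in> V <+>\<^bsub>R\<^esub> W" if r: "r \<in> carrier R" and u: "u \<in> V <+>\<^bsub>R\<^esub> W" for r u
  proof -
    from u obtain v w where vw: "v \<in> V" "w \<in> W" "u = v \<oplus> w"
      by (auto simp: set_add_def')
    then have "r \<otimes> u = r \<otimes> v \<oplus> r \<otimes> w"
      using r sub by (simp add: r_distr subsetD)
    moreover have "r \<otimes> v \<in> V" "r \<otimes> w \<in> W"
      using left_ideal_mult_closed V W r vw by auto
    ultimately show ?thesis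
      by (auto simp: set_add_def')
  qed
  ultimately show ?thesis
    unfolding subalgebra_def subalgebra_axioms_def by blast
qed

lemma left_ideal_right_translate:
  assumes V: "subalgebra (carrier R) V R" and b: "b \<in> carrier R"
  shows "subalgebra (carrier R) ((\<lambda>v. v \<otimes> b) ` V) R"
proof -
  have sub: "V \<subseteq> carrier R"
    using V subalgebra_in_carrier by auto
  interpret V: subalgebra "carrier R" V R by (rule V)
  have "subgroup ((\<lambda>v. v \<otimes> b) ` V) (add_monoid R)"
  proof (rule add.subgroupI)
    show "(\<lambda>v. v \<otimes> b) ` V \<subseteq> carrier R"
      using sub b by auto
    show "(\<lambda>v. v \<otimes> b) ` V \<noteq> {}"
      using V.one_closed by auto
  next
    fix u assume "u \<in> (\<lambda>v. v \<otimes> b) ` V"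
    then obtain v where v: "v \<in> V" "u = v \<otimes> b" by blast
    have "\<ominus> v \<in> V"
      using V.m_inv_closed[OF v(1)] by (simp add: a_inv_def)
    moreover have "\<ominus> u = (\<ominus> v) \<otimes> b"
      using v sub b by (simp add: l_minus subsetD)
    ultimately show "\<ominus> u \<in> (\<lambda>v. v \<otimes> b) ` V" by blast
  next
    fix u u' assume "u \<in> (\<lambda>v. v \<otimes> b) ` V" "u' \<in> (\<lambda>v. v \<otimes> b) ` V"
    then obtain v v' where v: "v \<in> V" "u = v \<otimes> b" "v' \<in> V" "u' = v' \<otimes> b" by blast
    have "v \<oplus> v' \<in> V"
      using V.m_closed[OF v(1,3)] by simp
    moreover have "u \<oplus> u' = (v \<oplus> v') \<otimes> b"
      using v sub b by (simp add: l_distr subsetD)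
    ultimately show "u \<oplus> u' \<in> (\<lambda>v. v \<otimes> b) ` V" by blast
  qed
  moreover have "r \<otimes> u \<in> (\<lambda>v. v \<otimes> b) ` V" if r: "r \<in> carrier R" and u: "u \<in> (\<lambda>v. v \<otimes> b) ` V" for r u
  proof -
    from u obtain v where v: "v \<in> V" "u = v \<otimes> b" by blast
    then have "r \<otimes> u = (r \<otimes> v) \<otimes> b"
      using r sub b by (simp add: m_assoc subsetD)
    moreover have "r \<otimes> v \<in> V"
      using left_ideal_mult_closed V r v by auto
    ultimately show ?thesis by blast
  qed
  ultimately show ?thesis
    unfolding subalgebra_def subalgebra_axioms_def by blast
qed

text \<open>A basis of \<open>W\<close> is independent in \<open>V\<close>, so it has at most
  \<open>n\<close> elements, and if it has exactly \<open>n\<close> it spans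
  \<open>V\<close>.\<close>

lemma subspace_dimension_eq:
  assumes K: "subfield K R" and n: "dimension n K V" and W: "subalgebra K W R" "W \<subseteq> V"
  obtains m where "dimension m K W" "m \<le> n" "m = n \<Longrightarrow> W = V"
proof -
  obtain m where m: "dimension m K W"
    using subalbegra_incl_imp_finite_dimension[OF K finite_dimensionI[OF n] W] by blast
  obtain Us where Us: "independent K Us" "length Us = m" "Span K Us = W"
    using exists_base[OF K m] by blast
  have "set Us \<subseteq> V"
    using Span_base_incl[OF K independent_in_carrier[OF Us(1)]] Us(3) W(2) by blast
  then show thesis
    using that[OF m] independent_length_le_dimension[OF K n Us(1)]
      independent_length_eq_dimension[OF K n Us(1)] Us by auto
qed

text \<open>
  Wedderburn's argument: for a left ideal \<open>L\<close> of minimal positive dimension, every right translate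
  \<open>L b\<close> either vanishes or has the dimension of \<open>L\<close> and meets each left ideal trivially or in full,
  and by simplicity the translates span the whole ring.
\<close>

lemma simple_ring_left_ideal_dimension_dvd:
  assumes K: "subfield K R" and n: "dimension n K (carrier R)"
    and simple: "\<And>I. ideal I R \<Longrightarrow> I \<noteq> {\<zero>} \<Longrightarrow> I = carrier R"
    and \<alpha>: "\<alpha> \<in> carrier R" "\<alpha> \<noteq> \<zero>" "\<And>r. r \<in> carrier R \<Longrightarrow> r \<otimes> \<alpha> \<noteq> \<one>"
  obtains L d where "subalgebra (carrier R) L R" "dimension d K L" "1 \<le> d" "d < n" "d dvd n"
proof -
  have K_sub: "K \<subseteq> carrier R"
    by (rule subfieldE(3)[OF K])
  define P where "P d \<longleftrightarrow> 0 < d \<and> (\<exists>L. subalgebra (carrier R) L R \<and> dimension d K L)" for d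
  have dim_ex: "\<exists>m. m \<le> k \<and> (m = k \<longrightarrow> V = W) \<and> (V \<noteq> {\<zero>} \<longrightarrow> P m)"
    if V: "subalgebra (carrier R) V R" "V \<subseteq> W" and k: "dimension k K W" for V W k
  proof -
    obtain m where m: "dimension m K V" "m \<le> k" "m = k \<Longrightarrow> V = W"
      using subspace_dimension_eq[OF K k left_ideal_subalgebra[OF V(1) K_sub] V(2)] by blast
    have "P m" if "V \<noteq> {\<zero>}"
    proof -
      have "m \<noteq> 0"
        using dimension_zero[OF K, of V] m(1) that by metis
      then show ?thesis
        unfolding P_def using V(1) m(1) by auto
    qed
    with m show ?thesis
      by blast
  qed
  have carrier_left: "subalgebra (carrier R) (carrier R) R"
    by (simp add: carrier_is_subalgebra)
  \<comment> \<open>Since \<open>\<alpha>\<close> has no left inverse, the left ideal generated by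
    it misses \<open>\<one>\<close>. It is nonzero and proper, which forces the least positive
    dimension \<open>d\<close> below \<open>n\<close>.\<close>
  define V where "V = (\<lambda>r. r \<otimes> \<alpha>) ` carrier R"
  have V: "subalgebra (carrier R) V R"
    unfolding V_def by (rule left_ideal_right_translate[OF carrier_left \<alpha>(1)])
  have "\<alpha> = \<one> \<otimes> \<alpha>"
    using \<alpha>(1) by simp
  then have "V \<noteq> {\<zero>}"
    unfolding V_def using \<alpha>(2) one_closed by blast
  have "\<one> \<notin> V"
    unfolding V_def image_iff using \<alpha>(3) by metis
  then have "V \<noteq> carrier R"
    by auto
  then obtain m where m: "P m" "m < n"
    using dim_ex[OF V subalgebra_in_carrier[OF V] n] \<open>V \<noteq> {\<zero>}\<close> le_neq_implies_less by blast
  define d where "d = (LEAST d. P d)"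
  have "P d"
    unfolding d_def using m(1) by (rule LeastI)
  have "d < n"
    using Least_le[of P, OF m(1)] m(2) unfolding d_def by simp
  have d_min: "d \<le> k" if "P k" for k
    unfolding d_def using that by (rule Least_le)
  obtain L where L: "subalgebra (carrier R) L R" "dimension d K L" and "0 < d"
    using \<open>P d\<close> unfolding P_def by blast
  have minimal: "V = {\<zero>} \<or> V = W" if "subalgebra (carrier R) V R" "V \<subseteq> W" "dimension d K W" for V W
  proof (cases "V = {\<zero>}")
    case False
    with dim_ex[OF that] obtain k where "k \<le> d" "k = d \<longrightarrow> V = W" "P k"
      by blast
    then show ?thesis
      using d_min[of k] by simp
  qed simp
  have L_sub: "L \<subseteq> carrier R"
    using L(1) by (rule subalgebra_in_carrier)
  have zero_in: "\<zero> \<in> V" if "subalgebra (carrier R) V R" for V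
    using subgroup.one_closed[of V "add_monoid R"] that by (simp add: subalgebra_def)
  have "L \<noteq> {\<zero>}"
    using dimension_is_inj[OF K L(2), of 0] zero_dim \<open>0 < d\<close> by auto
  \<comment> \<open>The kernel \<open>N\<close> of right multiplication by \<open>b\<close> on
    \<open>L\<close> is a left ideal strictly inside \<open>L\<close>, hence zero by minimality. So
    a basis of \<open>L\<close> is carried to a basis of its translate.\<close>
  have translate_dim: "dimension d K ((\<lambda>l. l \<otimes> b) ` L)"
    if b: "b \<in> carrier R" and ne: "\<exists>l\<in>L. l \<otimes> b \<noteq> \<zero>" for b
  proof -
    define N where "N = {l \<in> L. l \<otimes> b = \<zero>}"
    have "subalgebra (carrier R) N R"
    proof -
      interpret L: subalgebra "carrier R" L R by (rule L(1))
      have "subgroup N (add_monoid R)"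
      proof (rule add.subgroupI)
        show "N \<subseteq> carrier R"
          unfolding N_def using L_sub by blast
        have "\<zero> \<in> N"
          unfolding N_def using zero_in[OF L(1)] b by simp
        then show "N \<noteq> {}"
          by blast
      next
        fix u assume "u \<in> N"
        then show "\<ominus> u \<in> N"
          unfolding N_def using L.m_inv_closed[of u] L_sub b
          by (simp add: a_inv_def[symmetric] l_minus subsetD)
      next
        fix u v assume "u \<in> N" "v \<in> N"
        then show "u \<oplus> v \<in> N"
          unfolding N_def using L.m_closed[of u v] L_sub b by (auto simp: l_distr subset_iff)
      qed
      moreover have "r \<otimes> u \<in> N" if "r \<in> carrier R" "u \<in> N" for r u
        using that left_ideal_mult_closed[OF L(1)] L_sub b unfolding N_def by (auto simp: m_assoc subset_iff)
      ultimately show ?thesis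
        unfolding subalgebra_def subalgebra_axioms_def by blast
    qed
    then have "N = {\<zero>}"
      using minimal[of N L] L(2) ne unfolding N_def by blast
    then have inj: "l = \<zero>" if "l \<in> L" "l \<otimes> b = \<zero>" for l
      using that unfolding N_def by blast
    obtain Us where Us: "independent K Us" "length Us = d" "Span K Us = L"
      using exists_base[OF K L(2)] by blast
    note Us_sub = independent_in_carrier[OF Us(1)]
    let ?Vs = "map (\<lambda>u. u \<otimes> b) Us"
    have Vs_sub: "set ?Vs \<subseteq> carrier R"
      using Us_sub b by auto
    have comb: "combine Ks ?Vs = combine Ks Us \<otimes> b" if "set Ks \<subseteq> K" for Ks
      using combine_l_distr[of Ks Us b] that K_sub Us_sub b by auto
    have "independent K ?Vs"
    proof (rule trivial_combine_imp_independent[OF K Vs_sub])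
      fix Ks assume Ks: "set Ks \<subseteq> K" "combine Ks ?Vs = \<zero>"
      have "combine Ks Us \<in> L"
        using Span_eq_combine_set[OF K Us_sub] Us(3) Ks(1) by blast
      then have "combine Ks Us = \<zero>"
        using inj comb Ks by auto
      then show "set (take (length ?Vs) Ks) \<subseteq> {\<zero>}"
        using independent_imp_trivial_combine[OF K Us(1) Ks(1)] by simp
    qed
    moreover have "Span K ?Vs = (\<lambda>l. l \<otimes> b) ` L"
    proof -
      have "Span K ?Vs = {combine Ks Us \<otimes> b |Ks. set Ks \<subseteq> K}"
        unfolding Span_eq_combine_set[OF K Vs_sub]
        by (intro Collect_cong ex_cong1 rev_conj_cong refl) (simp only: comb)
      also have "\<dots> = (\<lambda>l. l \<otimes> b) ` Span K Us"
        unfolding Span_eq_combine_set[OF K Us_sub] by blast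
      finally show ?thesis
        unfolding Us(3) .
    qed
    ultimately show ?thesis
      using dimensionI[OF K, of ?Vs] Us(2) by simp
  qed
  \<comment> \<open>Among the left ideals whose dimension is a multiple of \<open>d\<close>, a
    largest one \<open>W\<close> is taken. The goal is that \<open>W\<close> is the whole ring, so
    that \<open>d\<close> divides \<open>n\<close>.\<close>
  define Q where "Q e \<longleftrightarrow> d dvd e \<and> (\<exists>W. subalgebra (carrier R) W R \<and> dimension e K W)" for e
  have Q_le: "e \<le> n" if Q: "Q e" for e
  proof -
    obtain W where W: "subalgebra (carrier R) W R" "dimension e K W"
      using Q unfolding Q_def by blast
    obtain m where "dimension m K W" "m \<le> n"
      using subspace_dimension_eq[OF K n left_ideal_subalgebra[OF W(1) K_sub] subalgebra_in_carrier[OF W(1)]]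
      by blast
    then show ?thesis
      using dimension_is_inj[OF K W(2)] by simp
  qed
  have "Q d"
    unfolding Q_def using L by auto
  define e where "e = (GREATEST e. Q e)"
  have "Q e"
    unfolding e_def by (rule GreatestI_nat[where P = Q, OF \<open>Q d\<close>]) (rule Q_le)
  have e_max: "k \<le> e" if "Q k" for k
    unfolding e_def by (rule Greatest_le_nat[where P = Q, OF that]) (rule Q_le)
  obtain W where W: "subalgebra (carrier R) W R" "dimension e K W" and "d dvd e"
    using \<open>Q e\<close> unfolding Q_def by blast
  \<comment> \<open>A translate not inside \<open>W\<close> would meet \<open>W\<close> in zero by
    minimality. The sum would then be direct of dimension \<open>e + d\<close>, against the choice
    of \<open>e\<close>.\<close>
  have translate_sub: "(\<lambda>l. l \<otimes> b) ` L \<subseteq> W" if b: "b \<in> carrier R" for b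
  proof (rule ccontr)
    let ?M = "(\<lambda>l. l \<otimes> b) ` L"
    assume not_sub: "\<not> ?M \<subseteq> W"
    then have "\<exists>l\<in>L. l \<otimes> b \<noteq> \<zero>"
      using zero_in[OF W(1)] by auto
    then have M_dim: "dimension d K ?M"
      by (rule translate_dim[OF b])
    have M: "subalgebra (carrier R) ?M R"
      by (rule left_ideal_right_translate[OF L(1) b])
    have "W \<inter> ?M = {\<zero>}"
      using minimal[OF subalgebra_inter[OF W(1) M] _ M_dim] not_sub by auto
    then have "dimension (e + d) K (W <+>\<^bsub>R\<^esub> ?M)"
      by (rule dimension_direct_sum_space[OF K W(2) M_dim])
    then have "Q (e + d)"
      unfolding Q_def using left_ideal_sum[OF W(1) M] \<open>d dvd e\<close> by auto
    then show False
      using e_max \<open>0 < d\<close> by fastforce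
  qed
  \<comment> \<open>This is the largest two-sided ideal inside \<open>W\<close>. It contains
    \<open>L\<close>, so simplicity makes it the whole ring and puts \<open>\<one>\<close> into
    \<open>W\<close>.\<close>
  define I where "I = {u \<in> carrier R. \<forall>b\<in>carrier R. u \<otimes> b \<in> W}"
  have "ideal I R"
  proof (rule idealI)
    show "ring R" by (rule ring_axioms)
    interpret W: subalgebra "carrier R" W R by (rule W(1))
    show "subgroup I (add_monoid R)"
    proof (rule add.subgroupI)
      show "I \<subseteq> carrier R" "I \<noteq> {}"
        unfolding I_def using zero_in[OF W(1)] by (auto intro!: exI[of _ \<zero>])
    next
      fix u assume "u \<in> I"
      then show "\<ominus> u \<in> I"
        unfolding I_def using W.m_inv_closed by (auto simp: a_inv_def[symmetric] l_minus)
    next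
      fix u v assume "u \<in> I" "v \<in> I"
      then show "u \<oplus> v \<in> I"
        unfolding I_def using W.m_closed by (auto simp: l_distr)
    qed
    show "x \<otimes> u \<in> I" if "u \<in> I" "x \<in> carrier R" for u x
      using that left_ideal_mult_closed[OF W(1)] unfolding I_def by (auto simp: m_assoc)
    show "u \<otimes> x \<in> I" if "u \<in> I" "x \<in> carrier R" for u x
      using that unfolding I_def by (auto simp: m_assoc)
  qed
  moreover have "L \<subseteq> I"
    unfolding I_def using translate_sub L_sub by blast
  ultimately have "I = carrier R"
    using simple \<open>L \<noteq> {\<zero>}\<close> zero_in[OF L(1)] by blast
  then have "\<one> \<in> I"
    by simp
  then have "\<one> \<otimes> \<one> \<in> W"
    unfolding I_def by blast
  then have "\<one> \<in> W"
    by simp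
  then have "carrier R \<subseteq> W"
    using left_ideal_mult_closed[OF W(1) _ \<open>\<one> \<in> W\<close>] by fastforce
  then have "W = carrier R"
    using subalgebra_in_carrier[OF W(1)] by blast
  then have "e = n"
    using dimension_is_inj[OF K W(2)] n by simp
  then show thesis
    using that[OF L] \<open>0 < d\<close> \<open>d < n\<close> \<open>d dvd e\<close> by simp
qed

end

section \<open>The symbol algebra\<close>

text \<open>Zero counts as a monomial with coefficient zero, so a nonempty sum of monomials is the
  general case.\<close>

lemma poly_mapping_single_induct [case_names single add]:
  assumes "\<And>k v. P (Poly_Mapping.single k v)"
    and "\<And>f g. P f \<Longrightarrow> P g \<Longrightarrow> P (f + g)"
  shows "P (f :: 'k \<Rightarrow>\<^sub>0 'v::comm_monoid_add)"
proof (induction f rule: update_induct)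
  case const
  show ?case
    using assms(1)[of _ 0] by simp
next
  case (update f k v)
  have "Poly_Mapping.update k v f = f + Poly_Mapping.single k v"
    using update(1) by (intro poly_mapping_eqI)
      (auto simp: lookup_update lookup_add lookup_single in_keys_iff when_def)
  then show ?case
    using assms update by simp
qed

section \<open>Scalars and word induction in the free algebra\<close>

lemma free_scalar_simps:
  "free_scalar 0 = 0" "free_scalar 1 = 1"
  "free_scalar (c + d) = free_scalar c + free_scalar d"
  "free_scalar (c * d) = free_scalar c * free_scalar d"
  "free_scalar c * Poly_Mapping.single w d = Poly_Mapping.single w (c * d)"
  by (simp_all add: free_scalar_def single_add mult_single)

lemma free_scalar_central: "f * free_scalar c = free_scalar c * f"
  by (induction f rule: poly_mapping_single_induct)
    (simp_all add: free_scalar_def mult_single algebra_simps)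

lemma free_scalar_left_commute: "f * (free_scalar c * g) = free_scalar c * (f * g)"
  using free_scalar_central[of f c] by (metis mult.assoc)

text \<open>Every monomial arises from a scalar by prefixing letters. Putting the generator on the
  left fits left actions and left ideals.\<close>

lemma free_alg_induct [case_names scalar gen add]:
  assumes "\<And>c. P (free_scalar c)"
    and "\<And>g f. P f \<Longrightarrow> P (free_gen g * f)"
    and "\<And>f g. P f \<Longrightarrow> P g \<Longrightarrow> P (f + g)"
  shows "P (f :: 'a::field free_alg)"
proof (induction f rule: poly_mapping_single_induct)
  case (single w c)
  have "P (Poly_Mapping.single (Word gs) c)" for gs
  proof (induction gs)
    case Nil
    then show ?case
      using assms(1)[of c] by (simp add: free_scalar_def zero_free_word_def)
  next
    case (Cons g gs)
    then show ?case
      using assms(2)[OF Cons.IH, of g] by (simp add: free_gen_def mult_single)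
  qed
  then show ?case
    by (cases w) simp
qed (rule assms(3))

section \<open>Rescaling the variable of a polynomial\<close>

lemma smult_sum_right: "smult c (sum f A) = (\<Sum>i\<in>A. smult c (f i))"
  by (induction A rule: infinite_finite_induct) (simp_all add: smult_add_right)

text \<open>This is \<open>p(cX)\<close>. With \<open>c = q ^ k\<close> it represents the
  \<open>k\<close>-th power of \<open>\<sigma>\<close> on E(s).\<close>

definition scale_arg :: "'a::field \<Rightarrow> 'a poly \<Rightarrow> 'a poly" where
  "scale_arg c p = pcompose p [:0, c:]"

lemma scale_arg_simps [simp]:
  "scale_arg c 0 = 0" "scale_arg c 1 = 1" "scale_arg c [:u:] = [:u:]"
  "scale_arg 1 p = p"
  by (simp_all add: scale_arg_def pcompose_1)

lemma scale_arg_hom: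
  "scale_arg c (p + p') = scale_arg c p + scale_arg c p'"
  "scale_arg c (p - p') = scale_arg c p - scale_arg c p'"
  "scale_arg c (p * p') = scale_arg c p * scale_arg c p'"
  "scale_arg c (smult u p) = smult u (scale_arg c p)"
  "scale_arg c (sum f A) = (\<Sum>i\<in>A. scale_arg c (f i))"
  by (simp_all add: scale_arg_def pcompose_add pcompose_diff pcompose_mult pcompose_smult pcompose_sum)

lemma scale_arg_scale_arg: "scale_arg c (scale_arg d p) = scale_arg (c * d) p"
  by (simp add: scale_arg_def pcompose_pCons mult.commute flip: pcompose_assoc)

lemma scale_arg_pCons: "scale_arg c (pCons u p) = pCons u (smult c (scale_arg c p))"
  by (simp add: scale_arg_def pcompose_pCons)

lemma scale_arg_monom: "scale_arg c (monom u k) = monom (u * c ^ k) k"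
  by (induction k) (simp_all add: monom_0 monom_Suc scale_arg_pCons smult_monom algebra_simps)

text \<open>Polynomial representatives of the entries of \<open>twisted_power\<close>, with no
  reduction modulo \<open>r\<close>. The most twisted factor stands on the left.\<close>

primrec poly_twisted_power ::
  "'a::field \<Rightarrow> nat \<Rightarrow> (nat \<Rightarrow> nat \<Rightarrow> 'a poly) \<Rightarrow> nat \<Rightarrow> nat \<Rightarrow> nat \<Rightarrow> 'a poly" where
  "poly_twisted_power q d m 0 i j = (if i = j then 1 else 0)"
| "poly_twisted_power q d m (Suc k) i j =
     (\<Sum>l<d. scale_arg (q ^ k) (m i l) * poly_twisted_power q d m k l j)"

text \<open>Gaussian elimination modulo \<open>r\<close>, by induction on the number of coordinates:
  a vector whose last coordinate is invertible modulo \<open>r\<close> clears that coordinate from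
  the others and is then set aside.\<close>

lemma linear_dependence_mod:
  fixes r :: "'a::comm_ring_1"
  assumes r: "\<not> r dvd 1" and inv: "\<And>p. \<not> r dvd p \<Longrightarrow> \<exists>p'. r dvd p' * p - 1"
    and "finite S" "d < card S"
  shows "\<exists>c. (\<exists>j\<in>S. \<not> r dvd c j) \<and> (\<forall>i<d. r dvd (\<Sum>j\<in>S. c j * v j i))"
  using assms(3,4)
proof (induction d arbitrary: S v)
  case 0
  then have "S \<noteq> {}" by auto
  then show ?case
    using r by (intro exI[of _ "\<lambda>_. 1"]) auto
next
  case (Suc d)
  show ?case
  proof (cases "\<forall>j\<in>S. r dvd v j d")
    case True
    obtain c where "\<exists>j\<in>S. \<not> r dvd c j" "\<forall>i<d. r dvd (\<Sum>j\<in>S. c j * v j i)"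
      using Suc.IH[of S v] Suc.prems by auto
    moreover have "r dvd (\<Sum>j\<in>S. c j * v j d)"
      using True by (intro dvd_sum) auto
    ultimately show ?thesis
      by (intro exI[of _ c]) (auto simp: less_Suc_eq)
  next
    case False
    then obtain t where t: "t \<in> S" "\<not> r dvd v t d"
      by blast
    then obtain u where u: "r dvd u * v t d - 1"
      using inv by blast
    define w where "w j i = v j i - u * v j d * v t i" for j i
    have *: "d < card (S - {t})"
      using Suc.prems t(1) by (simp add: card_Diff_singleton less_diff_conv)
    obtain c where c: "\<exists>j\<in>S - {t}. \<not> r dvd c j" "\<forall>i<d. r dvd (\<Sum>j\<in>S - {t}. c j * w j i)"
      using Suc.IH[of "S - {t}" w] * Suc.prems(1) by auto
    \<comment> \<open>The coefficient at the pivot \<open>t\<close> collects the multiples of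
      \<open>v t\<close> subtracted in \<open>w\<close>, so the two sums agree exactly and not only
      modulo \<open>r\<close>.\<close>
    define c' where "c' = c(t := - (\<Sum>j\<in>S - {t}. c j * u * v j d))"
    have eq: "(\<Sum>j\<in>S. c' j * v j i) = (\<Sum>j\<in>S - {t}. c j * w j i)" for i
    proof -
      have "(\<Sum>j\<in>S. c' j * v j i) = c' t * v t i + (\<Sum>j\<in>S - {t}. c' j * v j i)"
        using Suc.prems(1) t(1) by (rule sum.remove)
      also have "(\<Sum>j\<in>S - {t}. c' j * v j i) = (\<Sum>j\<in>S - {t}. c j * v j i)"
        by (intro sum.cong) (auto simp: c'_def)
      finally show ?thesis
        by (simp add: c'_def w_def algebra_simps sum_subtractf sum_distrib_left)
    qed
    have "r dvd w j d" for j
    proof -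
      have "w j d = - ((u * v t d - 1) * v j d)"
        by (simp add: w_def algebra_simps)
      then show ?thesis
        using u by simp
    qed
    then have "r dvd (\<Sum>j\<in>S - {t}. c j * w j d)"
      by (intro dvd_sum) simp
    with c have "\<forall>i<Suc d. r dvd (\<Sum>j\<in>S. c' j * v j i)"
      by (auto simp: eq less_Suc_eq)
    moreover have "\<exists>j\<in>S. \<not> r dvd c' j"
      using c(1) by (auto simp: c'_def)
    ultimately show ?thesis
      by blast
  qed
qed

text \<open>
  The generator names are parameters so that both halves of the theorem are instances of one result.
\<close>

locale symbol_presentation =
  fixes n :: nat and q s a :: "'a::field" and gh gx :: generator
  assumes n_pos: "0 < n" and primitive: "primitive_nth_root n q" and gh_neq_gx: "gh \<noteq> gx"
begin

definition h :: "'a free_alg" where "h = free_gen gh"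
definition x :: "'a free_alg" where "x = free_gen gx"

definition r :: "'a poly" where "r = monom 1 n - [:s:]"

definition relations :: "'a free_alg set" where
  "relations = {x * h - free_scalar q * h * x, h ^ n - free_scalar s, x ^ n - free_scalar a}"

definition J :: "'a free_alg set" where
  "J = Idl\<^bsub>ring_of_type_algebra\<^esub> relations"

sublocale type_ideal J
  unfolding type_ideal_def J_def
  by (rule ring.genideal_ideal[OF ring_ring_of_type_algebra]) simp

notation cong_mod (infix \<open>\<doteq>\<close> 50)

lemma relations_subset: "relations \<subseteq> J"
  unfolding J_def by (rule ring.genideal_self[OF ring_ring_of_type_algebra]) simp

lemma xh: "x * h \<doteq> free_scalar q * h * x" and h_pow_n: "h ^ n \<doteq> free_scalar s"
  and x_pow_n: "x ^ n \<doteq> free_scalar a"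
  using relations_subset by (auto simp: relations_def cong_mod_def)

lemma gen_cases: "g = gh \<or> g = gx"
  using gh_neq_gx by (cases g; cases gh; cases gx) auto

lemma q_pow_n: "q ^ n = 1"
  using primitive by (simp add: primitive_nth_root_def)

lemma q_nonzero: "q \<noteq> 0"
  using q_pow_n n_pos by (auto simp: power_0_left)

text \<open>Distinct powers of \<open>q\<close> are what allows commutators with \<open>h\<close> to
  separate the powers of \<open>x\<close>.\<close>

lemma q_pow_inj:
  assumes "i < n" "j < n" "q ^ i = q ^ j"
  shows "i = j"
proof -
  have *: "i = j" if "i \<le> j" "j < n" "q ^ i = q ^ j" for i j
  proof (rule ccontr)
    assume "i \<noteq> j"
    have "q ^ i * q ^ (j - i) = q ^ (i + (j - i))"
      by (simp only: power_add)
    also have "\<dots> = q ^ i * 1"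
      using that by simp
    finally have "q ^ i * q ^ (j - i) = q ^ i * 1" .
    then have "q ^ (j - i) = 1"
      using q_nonzero by simp
    with primitive \<open>i \<noteq> j\<close> that show False
      by (simp add: primitive_nth_root_def)
  qed
  show ?thesis
    using *[of i j] *[of j i] assms by (cases "i \<le> j") auto
qed

text \<open>Because \<open>q ^ n = 1\<close>, the substitution fixes the modulus and so descends to
  E(s).\<close>

lemma scale_arg_r: "scale_arg q r = r"
  by (simp add: r_def scale_arg_hom scale_arg_monom q_pow_n)

lemma not_r_dvd_1: "\<not> r dvd 1"
proof -
  have "Polynomial.coeff r n \<noteq> 0"
    unfolding r_def using n_pos by (simp add: coeff_pCons split: nat.split)
  then have "n \<le> Polynomial.degree r"
    by (rule le_degree)
  then show ?thesis
    using dvd_imp_degree_le[of r 1] n_pos by auto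
qed

text \<open>Horner evaluation at \<open>h\<close>, which lifts E(s) to the free algebra.\<close>

definition ev :: "'a poly \<Rightarrow> 'a free_alg" where
  "ev p = fold_coeffs (\<lambda>c f. free_scalar c + h * f) p 0"

lemma ev_0 [simp]: "ev 0 = 0"
  by (simp add: ev_def)

lemma ev_pCons: "ev (pCons c p) = free_scalar c + h * ev p"
  by (cases "p = 0 \<and> c = 0") (auto simp: ev_def free_scalar_simps)

lemma ev_const: "ev [:c:] = free_scalar c"
  by (simp add: ev_pCons)

lemma ev_1 [simp]: "ev 1 = 1"
  by (simp add: one_pCons ev_const free_scalar_simps)

lemma ev_X: "ev [:0, 1:] = h"
  by (simp add: ev_pCons free_scalar_simps)

lemma ev_add: "ev (p + p') = ev p + ev p'"
  by (induction p p' rule: poly_induct2) (simp_all add: ev_pCons free_scalar_simps algebra_simps)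

lemma ev_smult: "ev (smult c p) = free_scalar c * ev p"
  by (induction p)
    (simp_all add: ev_pCons free_scalar_simps distrib_left free_scalar_left_commute mult.assoc)

lemma ev_mult: "ev (p * p') = ev p * ev p'"
  by (induction p) (simp_all add: ev_pCons ev_add ev_smult free_scalar_simps algebra_simps)

lemma ev_diff: "ev (p - p') = ev p - ev p'"
  using ev_add[of "p - p'" p'] by (simp add: algebra_simps)

lemma ev_power: "ev (p ^ k) = ev p ^ k"
  by (induction k) (simp_all add: ev_mult)

lemma ev_sum: "ev (sum f A) = (\<Sum>i\<in>A. ev (f i))"
  by (induction A rule: infinite_finite_induct) (simp_all add: ev_add)

lemma ev_mem: "r dvd p \<Longrightarrow> ev p \<in> J"
proof -
  assume "r dvd p"
  then obtain p' where p: "p = r * p'" ..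
  have "ev (Polynomial.monom 1 n) = h ^ n"
    using ev_power[of "[:0, 1:]" n] by (simp add: ev_X monom_altdef)
  then have "ev r \<in> J"
    using h_pow_n by (simp add: r_def ev_diff ev_const cong_mod_def)
  then show "ev p \<in> J"
    unfolding p ev_mult by (rule mult_right_mem)
qed

lemma ev_cong: "r dvd p - p' \<Longrightarrow> ev p \<doteq> ev p'"
  using ev_mem[of "p - p'"] by (simp add: cong_mod_def ev_diff)

text \<open>The relation \<open>xh\<close>, propagated along Horner's scheme: moving
  \<open>x\<close> past a polynomial in \<open>h\<close> applies \<open>\<sigma>\<close> to
  it.\<close>

lemma x_ev: "x * ev p \<doteq> ev (scale_arg q p) * x"
proof (induction p)
  case (pCons c p)
  have "x * ev (pCons c p) = free_scalar c * x + x * h * ev p"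
    by (simp add: ev_pCons algebra_simps free_scalar_central)
  also have "\<dots> \<doteq> free_scalar c * x + free_scalar q * h * x * ev p"
    by (intro cong_add cong_mult cong_refl xh)
  also have "free_scalar c * x + free_scalar q * h * x * ev p
      = free_scalar c * x + free_scalar q * h * (x * ev p)"
    by (simp add: mult.assoc)
  also have "\<dots> \<doteq> free_scalar c * x + free_scalar q * h * (ev (scale_arg q p) * x)"
    by (intro cong_add cong_mult cong_refl pCons.IH)
  also have "\<dots> = ev (scale_arg q (pCons c p)) * x"
    by (simp add: ev_pCons scale_arg_pCons ev_smult algebra_simps free_scalar_left_commute)
  finally show ?case .
qed simp

lemma x_pow_ev: "x ^ k * ev p \<doteq> ev (scale_arg (q ^ k) p) * x ^ k"
proof (induction k)
  case (Suc k)
  have "x ^ Suc k * ev p = x * (x ^ k * ev p)"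
    by (simp add: mult.assoc)
  also have "\<dots> \<doteq> x * (ev (scale_arg (q ^ k) p) * x ^ k)"
    by (intro cong_mult cong_refl Suc.IH)
  also have "\<dots> = x * ev (scale_arg (q ^ k) p) * x ^ k"
    by (simp add: mult.assoc)
  also have "\<dots> \<doteq> ev (scale_arg q (scale_arg (q ^ k) p)) * x * x ^ k"
    by (intro cong_mult cong_refl x_ev)
  finally show ?case
    by (simp add: scale_arg_scale_arg mult.assoc)
qed simp

text \<open>Sums of this shape are stable under left multiplication by both generators:
  \<open>h\<close> multiplies the coefficients by \<open>X\<close>, while \<open>x\<close> twists
  and shifts them.\<close>

lemma spanning: "\<exists>c. f \<doteq> (\<Sum>j<n. ev (c j) * x ^ j)"
proof (induction f rule: free_alg_induct)
  case (scalar u)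
  have "(\<Sum>j<n. ev (if j = 0 then [:u:] else 0) * x ^ j) = (\<Sum>j<n. if j = 0 then free_scalar u else 0)"
    by (intro sum.cong) (auto simp: ev_const)
  also have "\<dots> = free_scalar u"
    using n_pos by simp
  finally show ?case
    by (intro exI[of _ "\<lambda>j. if j = 0 then [:u:] else 0"]) simp
next
  case (gen g f)
  then obtain c where c: "f \<doteq> (\<Sum>j<n. ev (c j) * x ^ j)"
    by blast
  show ?case
  proof (cases "g = gh")
    case True
    have "free_gen g * f \<doteq> h * (\<Sum>j<n. ev (c j) * x ^ j)"
      using cong_mult[OF cong_refl c, of h] by (simp add: True h_def)
    also have "\<dots> = (\<Sum>j<n. ev ([:0, 1:] * c j) * x ^ j)"
      by (simp only: ev_mult ev_X sum_distrib_left mult.assoc)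
    finally show ?thesis
      by (intro exI[of _ "\<lambda>j. [:0, 1:] * c j"])
  next
    case False
    then have g: "g = gx"
      using gen_cases by blast
    obtain k where k: "n = Suc k"
      using n_pos gr0_conv_Suc by blast
    \<comment> \<open>The shift by one wraps around: the top coefficient meets \<open>x ^ n\<close>
      and returns to position 0 with the factor \<open>a\<close>.\<close>
    define c' where "c' j = (if j = 0 then smult a (scale_arg q (c k)) else scale_arg q (c (j - 1)))" for j
    have "free_gen g * f \<doteq> x * (\<Sum>j<n. ev (c j) * x ^ j)"
      using cong_mult[OF cong_refl c, of x] by (simp add: g x_def)
    also have "\<dots> = (\<Sum>j<n. x * ev (c j) * x ^ j)"
      by (simp add: sum_distrib_left mult.assoc)
    also have "\<dots> \<doteq> (\<Sum>j<n. ev (scale_arg q (c j)) * x * x ^ j)"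
      by (intro cong_sum cong_mult cong_refl x_ev)
    also have "\<dots> = ev (scale_arg q (c k)) * x ^ n + (\<Sum>j<k. ev (scale_arg q (c j)) * x ^ Suc j)"
      by (simp add: k mult.assoc)
    also have "\<dots> \<doteq> ev (scale_arg q (c k)) * free_scalar a + (\<Sum>j<k. ev (scale_arg q (c j)) * x ^ Suc j)"
      by (intro cong_add cong_mult cong_refl x_pow_n)
    also have "\<dots> = (\<Sum>j<n. ev (c' j) * x ^ j)"
      unfolding k sum.lessThan_Suc_shift by (simp add: c'_def ev_smult free_scalar_central)
    finally show ?thesis
      by (intro exI[of _ c'])
  qed
next
  case (add f g)
  then obtain c c' where "f \<doteq> (\<Sum>j<n. ev (c j) * x ^ j)" "g \<doteq> (\<Sum>j<n. ev (c' j) * x ^ j)"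
    by blast
  then have "f + g \<doteq> (\<Sum>j<n. ev (c j) * x ^ j) + (\<Sum>j<n. ev (c' j) * x ^ j)"
    by (rule cong_add)
  also have "\<dots> = (\<Sum>j<n. ev (c j + c' j) * x ^ j)"
    by (simp add: ev_add distrib_right sum.distrib)
  finally show ?case
    by (intro exI[of _ "\<lambda>j. c j + c' j"])
qed

end

section \<open>Modules given by matrices\<close>

text \<open>
  Row vectors over \<open>E(s)\<close> are represented by vectors of polynomials; equality in \<open>E(s)\<close> only
  enters through divisibility of differences by \<open>r\<close>.
\<close>

context symbol_presentation
begin

definition act_gen ::
  "nat \<Rightarrow> (nat \<Rightarrow> nat \<Rightarrow> 'a poly) \<Rightarrow> generator \<Rightarrow> (nat \<Rightarrow> 'a poly) \<Rightarrow> nat \<Rightarrow> 'a poly" where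
  "act_gen d m g v j = (if g = gh then [:0, 1:] * v j else \<Sum>i<d. scale_arg q (v i) * m i j)"

text \<open>With \<open>foldr\<close> the last letter acts first, so concatenation of words becomes
  composition and the action is a left action.\<close>

primrec act_word ::
  "nat \<Rightarrow> (nat \<Rightarrow> nat \<Rightarrow> 'a poly) \<Rightarrow> free_word \<Rightarrow> (nat \<Rightarrow> 'a poly) \<Rightarrow> nat \<Rightarrow> 'a poly" where
  "act_word d m (Word gs) v = foldr (act_gen d m) gs v"

text \<open>Linear extension to the free algebra, for an arbitrary \<open>m\<close>. The relations
  and the modulus \<open>r\<close> enter only in \<open>act_J\<close>.\<close>

definition act ::
  "nat \<Rightarrow> (nat \<Rightarrow> nat \<Rightarrow> 'a poly) \<Rightarrow> 'a free_alg \<Rightarrow> (nat \<Rightarrow> 'a poly) \<Rightarrow> nat \<Rightarrow> 'a poly" where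
  "act d m f v j = (\<Sum>w\<in>Poly_Mapping.keys f. smult (Poly_Mapping.lookup f w) (act_word d m w v j))"

lemma act_superset:
  assumes "finite A" "Poly_Mapping.keys f \<subseteq> A"
  shows "act d m f v j = (\<Sum>w\<in>A. smult (Poly_Mapping.lookup f w) (act_word d m w v j))"
  unfolding act_def using assms
  by (intro sum.mono_neutral_left) (auto simp: in_keys_iff)

lemma act_single: "act d m (Poly_Mapping.single w c) v j = smult c (act_word d m w v j)"
  by (subst act_superset[of "{w}"]) auto

lemma act_add: "act d m (f + g) v j = act d m f v j + act d m g v j"
proof -
  let ?A = "Poly_Mapping.keys f \<union> Poly_Mapping.keys g"
  have "Poly_Mapping.keys (f + g) \<subseteq> ?A"
    by (rule keys_add)
  then show ?thesis
    by (simp add: act_superset[of ?A] lookup_add smult_add_left sum.distrib)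
qed

lemma act_0 [simp]: "act d m 0 v j = 0"
  by (simp add: act_def)

lemma act_uminus: "act d m (- f) v j = - act d m f v j"
  using act_add[of d m f "- f" v j] by (simp add: eq_neg_iff_add_eq_0 add.commute)

lemma act_diff: "act d m (f - g) v j = act d m f v j - act d m g v j"
  using act_add[of d m f "- g" v j] by (simp add: act_uminus)

lemma act_sum: "act d m (sum f A) v j = (\<Sum>i\<in>A. act d m (f i) v j)"
  by (induction A rule: infinite_finite_induct) (simp_all add: act_add)

lemma act_scalar: "act d m (free_scalar c) v j = smult c (v j)"
  by (simp add: free_scalar_def act_single zero_free_word_def)

lemma act_1 [simp]: "act d m 1 v j = v j"
  using act_scalar[of d m 1 v j] by (simp add: free_scalar_simps)

lemma act_scalar_mult: "act d m (free_scalar c * f) v j = smult c (act d m f v j)"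
proof (induction f rule: poly_mapping_single_induct)
  case (single w u)
  then show ?case
    by (simp add: free_scalar_simps act_single)
qed (simp add: algebra_simps act_add smult_add_right)

lemma act_gen_add: "act_gen d m g (\<lambda>j. v j + w j) = (\<lambda>j. act_gen d m g v j + act_gen d m g w j)"
  by (auto simp: act_gen_def scale_arg_hom algebra_simps sum.distrib)

lemma act_gen_smult: "act_gen d m g (\<lambda>j. smult c (v j)) = (\<lambda>j. smult c (act_gen d m g v j))"
  by (auto simp: act_gen_def scale_arg_hom smult_sum_right)

lemma act_gen_mult: "act d m (free_gen g * f) v = act_gen d m g (act d m f v)"
proof (induction f rule: poly_mapping_single_induct)
  case (single w c)
  have "act d m (Poly_Mapping.single w c) v = (\<lambda>j. smult c (act_word d m w v j))"
    by (simp add: act_single fun_eq_iff)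
  then show ?case
    by (cases w) (simp add: fun_eq_iff free_gen_def mult_single act_single act_gen_smult)
next
  case (add f f')
  have "act d m (f + f') v = (\<lambda>j. act d m f v j + act d m f' v j)"
    by (simp add: act_add fun_eq_iff)
  then show ?case
    using add by (simp add: distrib_left act_add act_gen_add fun_eq_iff)
qed

lemma act_mult: "act d m (f * g) v = act d m f (act d m g v)"
proof (induction f rule: free_alg_induct)
  case (scalar c)
  then show ?case
    by (simp add: fun_eq_iff act_scalar act_scalar_mult)
next
  case (gen k f)
  then show ?case
    by (simp add: mult.assoc act_gen_mult)
next
  case (add f f')
  then show ?case
    by (simp add: distrib_right act_add fun_eq_iff)
qed

lemma act_h: "act d m h v j = [:0, 1:] * v j"
  using act_gen_mult[of d m gh 1 v] by (simp add: h_def act_gen_def fun_eq_iff)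

lemma act_x: "act d m x v j = (\<Sum>i<d. scale_arg q (v i) * m i j)"
  using act_gen_mult[of d m gx 1 v] gh_neq_gx by (simp add: x_def act_gen_def fun_eq_iff)

lemma act_ev: "act d m (ev p) v j = p * v j"
proof (induction p)
  case (pCons c p)
  have "act d m (ev (pCons c p)) v j = smult c (v j) + [:0, 1:] * (p * v j)"
    by (simp add: ev_pCons act_add act_scalar act_mult act_h pCons.IH)
  then show ?case
    by (simp add: mult_pCons_left)
qed simp

text \<open>The induction splits off the \<open>x\<close> that acts first. The remaining
  \<open>k\<close> copies apply the \<open>k\<close>-th twist to its matrix, which is the leftmost
  factor of the twisted power.\<close>

lemma act_x_pow:
  "j < d \<Longrightarrow> act d m (x ^ k) v j = (\<Sum>i<d. scale_arg (q ^ k) (v i) * poly_twisted_power q d m k i j)"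
proof (induction k arbitrary: v)
  case 0
  then show ?case
    by (simp add: if_distrib[of "\<lambda>y. _ * y"] cong: if_cong)
next
  case (Suc k)
  have "act d m (x ^ Suc k) v j = act d m (x ^ k) (act d m x v) j"
    by (simp add: power_Suc2 act_mult del: power_Suc)
  also have "\<dots> = (\<Sum>l<d. (\<Sum>i<d. scale_arg (q ^ Suc k) (v i) * scale_arg (q ^ k) (m i l))
      * poly_twisted_power q d m k l j)"
    using Suc.prems by (simp add: Suc.IH act_x scale_arg_hom scale_arg_scale_arg mult.commute)
  also have "\<dots> = (\<Sum>l<d. \<Sum>i<d. scale_arg (q ^ Suc k) (v i) *
      (scale_arg (q ^ k) (m i l) * poly_twisted_power q d m k l j))"
    by (simp add: sum_distrib_right mult.assoc)
  also have "\<dots> = (\<Sum>i<d. \<Sum>l<d. scale_arg (q ^ Suc k) (v i) *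
      (scale_arg (q ^ k) (m i l) * poly_twisted_power q d m k l j))"
    by (rule sum.swap)
  finally show ?case
    by (simp add: sum_distrib_left)
qed

text \<open>The matrix equation over E(s), read entry by entry on representatives.\<close>

definition twisted_root :: "nat \<Rightarrow> (nat \<Rightarrow> nat \<Rightarrow> 'a poly) \<Rightarrow> bool" where
  "twisted_root d m \<longleftrightarrow>
     (\<forall>i<d. \<forall>j<d. r dvd poly_twisted_power q d m n i j - (if i = j then [:a:] else 0))"

lemma r_dvd_scale_arg: "r dvd p \<Longrightarrow> r dvd scale_arg q p"
  by (metis dvd_def scale_arg_hom(3) scale_arg_r)

text \<open>Both generators map vectors of multiples of \<open>r\<close> to such vectors, since
  \<open>scale_arg q\<close> fixes \<open>r\<close>. Hence the action is defined over E(s).\<close>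

lemma r_dvd_act:
  assumes "\<And>j. j < d \<Longrightarrow> r dvd v j" "j < d"
  shows "r dvd act d m f v j"
  using assms(2)
proof (induction f arbitrary: j rule: free_alg_induct)
  case (scalar c)
  then show ?case
    by (simp add: act_scalar assms(1) dvd_smult)
next
  case (gen g f)
  then show ?case
    unfolding act_gen_mult act_gen_def
    by (cases "g = gh")
      (simp_all del: mult_pCons_left add: dvd_mult, intro dvd_sum dvd_mult2 r_dvd_scale_arg, simp)
next
  case (add f g)
  then show ?case
    by (simp add: act_add)
qed

text \<open>The elements that act as zero modulo \<open>r\<close> form a two-sided ideal containing
  the relations: the first acts as zero, the second as multiplication by \<open>r\<close>, and the
  third is controlled by \<open>twisted_root\<close>.\<close>

lemma act_J:
  assumes m: "twisted_root d m" and "f \<in> J" "j < d"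
  shows "r dvd act d m f v j"
proof -
  \<comment> \<open>Quantifying over all \<open>v\<close> gives closure under right multiplication;
    closure under left multiplication is \<open>r_dvd_act\<close>.\<close>
  define I where "I = {f. \<forall>v. \<forall>j<d. r dvd act d m f v j}"
  have "ideal I ring_of_type_algebra"
    by (rule ideal_ring_of_type_algebraI)
      (auto simp: I_def act_add act_mult r_dvd_act)
  moreover have "relations \<subseteq> I"
  proof -
    have "x * h - free_scalar q * h * x \<in> I"
      by (simp add: I_def act_diff act_mult act_x act_h act_scalar scale_arg_pCons scale_arg_hom
          sum_distrib_left mult.assoc mult_pCons_left smult_sum_right)
    moreover have "h ^ n - free_scalar s \<in> I"
    proof -
      have "act d m (h ^ n - free_scalar s) v j = r * v j" for v j
        using act_ev[of d m "[:0, 1:] ^ n" v j]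
        by (simp add: r_def act_diff act_scalar ev_power ev_X monom_altdef algebra_simps)
      then show ?thesis
        by (simp add: I_def)
    qed
    moreover have "x ^ n - free_scalar a \<in> I"
    proof -
      have "act d m (x ^ n - free_scalar a) v j =
          (\<Sum>i<d. v i * (poly_twisted_power q d m n i j - (if i = j then [:a:] else 0)))" if "j < d" for v j
      proof -
        have "(\<Sum>i<d. v i * (if i = j then [:a:] else 0)) = (\<Sum>i<d. if i = j then v i * [:a:] else 0)"
          by (intro sum.cong) auto
        also have "\<dots> = smult a (v j)"
          using that by simp
        finally show ?thesis
          using that by (simp add: act_diff act_scalar act_x_pow q_pow_n right_diff_distrib sum_subtractf)
      qed
      then show ?thesis
        using m by (auto simp: I_def twisted_root_def intro!: dvd_sum)
    qed
    ultimately show ?thesis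
      by (simp add: relations_def)
  qed
  ultimately have "J \<subseteq> I"
    unfolding J_def by (rule ring.genideal_minimal[OF ring_ring_of_type_algebra])
  with assms show ?thesis
    by (auto simp: I_def)
qed

text \<open>Row \<open>i\<close> lists the coordinates of \<open>x ^ Suc i\<close> in the basis
  \<open>1, x, ..., x ^ (n - 1)\<close>, so the module is the left regular one.\<close>

definition companion :: "nat \<Rightarrow> nat \<Rightarrow> 'a poly" where
  "companion i j = (if j = Suc i then 1 else if j = 0 \<and> Suc i = n then [:a:] else 0)"

text \<open>The entries are constants, so the twists disappear and the power is an ordinary one: a
  shift by \<open>k\<close> that picks up \<open>a\<close> when it wraps around.\<close>

lemma companion_twisted_power:
  assumes "k \<le> n" "i < n" "j < n"
  shows "poly_twisted_power q n companion k i j =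
    (if j = i + k then 1 else if j + n = i + k then [:a:] else 0)"
  using assms(1,2)
proof (induction k arbitrary: i)
  case 0
  then show ?case
    using assms(3) by auto
next
  case (Suc k)
  let ?T = "poly_twisted_power q n companion"
  have T: "?T (Suc k) i j = (\<Sum>l<n. companion i l * ?T k l j)"
    by (auto simp: companion_def intro!: sum.cong)
  show ?case
  proof (cases "Suc i < n")
    case True
    have "?T (Suc k) i j = (\<Sum>l<n. if l = Suc i then ?T k l j else 0)"
      unfolding T using True by (intro sum.cong) (auto simp: companion_def)
    also have "\<dots> = ?T k (Suc i) j"
      using True by simp
    finally show ?thesis
      using Suc True by simp
  next
    case False
    then have i: "Suc i = n"
      using Suc.prems by simp
    have "?T (Suc k) i j = (\<Sum>l<n. if l = 0 then [:a:] * ?T k l j else 0)"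
      unfolding T using i by (intro sum.cong) (auto simp: companion_def)
    also have "\<dots> = [:a:] * ?T k 0 j"
      using n_pos by simp
    finally show ?thesis
      using Suc.IH[of 0] Suc.prems i assms(3) by auto
  qed
qed

lemma companion_twisted_root: "twisted_root n companion"
  by (auto simp: twisted_root_def companion_twisted_power)

definition unit_vec :: "nat \<Rightarrow> 'a poly" where
  "unit_vec j = (if j = 0 then 1 else 0)"

lemma act_x_pow_unit_vec:
  assumes "j < d"
  shows "act d m (x ^ k) unit_vec j = poly_twisted_power q d m k 0 j"
proof -
  have "act d m (x ^ k) unit_vec j = (\<Sum>i<d. if i = 0 then poly_twisted_power q d m k i j else 0)"
    unfolding act_x_pow[OF assms] by (intro sum.cong) (auto simp: unit_vec_def)
  then show ?thesis
    using assms by simp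
qed

text \<open>In the companion module \<open>x ^ k\<close> sends the first unit vector to the
  \<open>k\<close>-th one, so a normal form returns its own coefficients.\<close>

lemma act_companion:
  assumes "j < n"
  shows "act n companion (\<Sum>k<n. ev (c k) * x ^ k) unit_vec j = c j"
proof -
  have "act n companion (\<Sum>k<n. ev (c k) * x ^ k) unit_vec j = (\<Sum>k<n. if k = j then c k else 0)"
    unfolding act_sum act_mult act_ev act_x_pow_unit_vec[OF assms]
    using assms n_pos by (intro sum.cong) (auto simp: companion_twisted_power)
  then show ?thesis
    using assms by simp
qed

lemma independence:
  assumes "(\<Sum>k<n. ev (c k) * x ^ k) \<in> J" "j < n"
  shows "r dvd c j"
  using act_J[OF companion_twisted_root assms, of unit_vec] by (simp add: act_companion[OF assms(2)])

text \<open>E(s) embeds into the symbol algebra: applied to the first unit vector of the companion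
  module, \<open>ev p\<close> has coordinate \<open>p\<close> at 0.\<close>

lemma ev_mem_iff: "ev p \<in> J \<longleftrightarrow> r dvd p"
proof
  assume "ev p \<in> J"
  then have "r dvd act n companion (ev p) unit_vec 0"
    using act_J[OF companion_twisted_root] n_pos by blast
  then show "r dvd p"
    by (simp add: act_ev unit_vec_def)
qed (rule ev_mem)

lemma one_notin_J: "1 \<notin> J"
  using ev_mem_iff[of 1] not_r_dvd_1 by simp

text \<open>The inverse \<open>g\<close> of \<open>ev p\<close> need not be visibly a polynomial in
  \<open>h\<close>; its coordinate at 0 in the companion module supplies \<open>p'\<close>.\<close>

lemma field_if_division:
  assumes div: "\<forall>f. f \<notin> J \<longrightarrow> (\<exists>g. g * f \<doteq> 1)" and p: "\<not> r dvd p"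
  shows "\<exists>p'. r dvd p' * p - 1"
proof -
  have "ev p \<notin> J"
    using p by (simp add: ev_mem_iff)
  then obtain g where g: "g * ev p \<doteq> 1"
    using div by blast
  then have "g \<notin> J"
    using mult_right_mem cong_mem one_notin_J by blast
  then obtain k where "k * g \<doteq> 1"
    using div by blast
  \<comment> \<open>The inverse is moved to the right of \<open>ev p\<close>, so that
    \<open>ev p\<close> acts last and just multiplies coordinate 0 by \<open>p\<close>.\<close>
  have "ev p \<doteq> k * g * ev p"
    using cong_mult[OF \<open>k * g \<doteq> 1\<close> cong_refl, of "ev p"] cong_sym by simp
  also have "k * g * ev p \<doteq> k"
    using cong_mult[OF cong_refl g, of k] by (simp add: mult.assoc)
  finally have "ev p * g \<doteq> 1"
    using cong_mult[of "ev p" k g g] \<open>k * g \<doteq> 1\<close> cong_trans by blast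
  then have "r dvd act n companion (ev p * g - 1) unit_vec 0"
    using act_J[OF companion_twisted_root] n_pos unfolding cong_mod_def by blast
  then have "r dvd p * act n companion g unit_vec 0 - 1"
    by (simp add: act_diff act_mult act_ev unit_vec_def[of 0])
  then show ?thesis
    by (auto simp: mult.commute)
qed

text \<open>If \<open>d < n\<close>, a linear relation between the vectors \<open>x ^ k\<close>
  applied to \<open>unit_vec\<close> is an element outside \<open>J\<close> by
  \<open>independence\<close>. It kills \<open>unit_vec\<close> modulo \<open>r\<close>, yet it has
  a left inverse, which gives \<open>r dvd 1\<close>.\<close>

lemma twisted_root_size_if_division:
  assumes div: "\<forall>f. f \<notin> J \<longrightarrow> (\<exists>g. g * f \<doteq> 1)" and d: "0 < d" and m: "twisted_root d m"
  shows "n \<le> d"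
proof (rule ccontr)
  assume "\<not> n \<le> d"
  then obtain c where c: "\<exists>k<n. \<not> r dvd c k"
    "\<forall>j<d. r dvd (\<Sum>k<n. c k * act d m (x ^ k) unit_vec j)"
    using linear_dependence_mod[of r "{..<n}" d "\<lambda>k j. act d m (x ^ k) unit_vec j"]
      not_r_dvd_1 field_if_division[OF div] by auto
  let ?f = "\<Sum>k<n. ev (c k) * x ^ k"
  have "?f \<notin> J"
    using c(1) independence by blast
  then obtain g where "g * ?f \<doteq> 1"
    using div by blast
  then have "r dvd act d m (g * ?f - 1) unit_vec 0"
    using act_J[OF m] d unfolding cong_mod_def by blast
  moreover have "r dvd act d m (g * ?f) unit_vec 0"
    unfolding act_mult
    by (rule r_dvd_act[OF _ d]) (use c(2) in \<open>simp add: act_sum act_mult act_ev\<close>)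
  ultimately have "r dvd 1"
    using dvd_diff[of r "act d m (g * ?f) unit_vec 0" "act d m (g * ?f - 1) unit_vec 0"]
    by (simp add: act_diff unit_vec_def)
  then show False
    using not_r_dvd_1 by blast
qed

end

section \<open>Left ideals of the symbol algebra\<close>

lemma list_range_conv_map_upt:
  assumes "set xs \<subseteq> range f" "length xs = d"
  obtains c where "xs = map (\<lambda>j. f (c j)) [0..<d]"
proof -
  have "\<forall>j<d. \<exists>y. f y = xs ! j"
    using assms by (metis imageE nth_mem subsetD)
  then obtain c where "\<forall>j<d. f (c j) = xs ! j"
    by metis
  with assms(2) have "xs = map (\<lambda>j. f (c j)) [0..<d]"
    by (intro nth_equalityI) auto
  then show thesis
    by (rule that)
qed

context symbol_presentation
begin

sublocale Q: ring quo
  by (rule quotient_is_ring)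

text \<open>The copy of E(s) inside the quotient; it serves as the scalar field for dimensions of
  left ideals.\<close>

definition base_field :: "'a free_alg set set" where
  "base_field = range (\<lambda>p. cls (ev p))"

lemma combine_cls:
  "Q.combine (map (\<lambda>j. cls (ev (c j))) [0..<d]) (map (\<lambda>j. cls (u j)) [0..<d])
    = cls (\<Sum>j<d. ev (c j) * u j)"
proof -
  have "Q.combine (map (\<lambda>j. cls (ev (c j))) js) (map (\<lambda>j. cls (u j)) js)
      = cls (\<Sum>j\<leftarrow>js. ev (c j) * u j)" for js :: "nat list"
    by (induction js) (simp_all add: cls_0 cls_mult cls_add)
  then show ?thesis
    by (simp add: interv_sum_list_conv_sum_set_nat lessThan_atLeast0)
qed

lemma base_field_subfield:
  assumes inv: "\<forall>p. \<not> r dvd p \<longrightarrow> (\<exists>p'. r dvd p' * p - 1)"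
  shows "subfield base_field quo"
proof (rule Q.subfieldI)
  have "subring base_field quo"
  proof (rule Q.subringI)
    show "base_field \<subseteq> carrier quo"
      by (auto simp: base_field_def)
    show "\<one>\<^bsub>quo\<^esub> \<in> base_field"
      unfolding base_field_def cls_1 using ev_1 by (metis rangeI)
  next
    fix k assume "k \<in> base_field"
    then obtain p where k: "k = cls (ev p)"
      by (auto simp: base_field_def)
    have "cls (ev (- p)) \<oplus>\<^bsub>quo\<^esub> cls (ev p) = \<zero>\<^bsub>quo\<^esub>"
      using ev_add[of "- p" p] by (simp add: cls_add cls_0)
    then have "\<ominus>\<^bsub>quo\<^esub> k = cls (ev (- p))"
      unfolding k by (rule Q.minus_equality) simp_all
    then show "\<ominus>\<^bsub>quo\<^esub> k \<in> base_field"
      by (simp add: base_field_def)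
  next
    fix k l assume "k \<in> base_field" "l \<in> base_field"
    then obtain p p' where kl: "k = cls (ev p)" "l = cls (ev p')"
      by (auto simp: base_field_def)
    show "k \<otimes>\<^bsub>quo\<^esub> l \<in> base_field" "k \<oplus>\<^bsub>quo\<^esub> l \<in> base_field"
      unfolding kl base_field_def cls_mult cls_add ev_mult[symmetric] ev_add[symmetric] by (rule rangeI)+
  qed
  moreover have comm: "k \<otimes>\<^bsub>quo\<^esub> l = l \<otimes>\<^bsub>quo\<^esub> k" if "k \<in> base_field" "l \<in> base_field" for k l
    using that by (auto simp: base_field_def cls_mult mult.commute simp flip: ev_mult)
  ultimately show "subcring base_field quo"
    by (rule Q.subcringI)
  show "Units (quo \<lparr>carrier := base_field\<rparr>) = base_field - {\<zero>\<^bsub>quo\<^esub>}"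
  proof (intro subset_antisym subsetI)
    fix k assume "k \<in> Units (quo \<lparr>carrier := base_field\<rparr>)"
    then obtain l where k: "k \<in> base_field" "l \<in> base_field" "l \<otimes>\<^bsub>quo\<^esub> k = \<one>\<^bsub>quo\<^esub>"
      by (auto simp: Units_def)
    have "l \<in> carrier quo"
      using k(2) by (auto simp: base_field_def)
    then have "l \<otimes>\<^bsub>quo\<^esub> \<zero>\<^bsub>quo\<^esub> = \<zero>\<^bsub>quo\<^esub>"
      by (rule Q.r_null)
    moreover have "\<one>\<^bsub>quo\<^esub> \<noteq> \<zero>\<^bsub>quo\<^esub>"
      using one_notin_J by (simp add: cls_1 cls_mem_zero_iff)
    ultimately have "k \<noteq> \<zero>\<^bsub>quo\<^esub>"
      using k(3) by metis
    with k(1) show "k \<in> base_field - {\<zero>\<^bsub>quo\<^esub>}"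
      by blast
  next
    fix k assume "k \<in> base_field - {\<zero>\<^bsub>quo\<^esub>}"
    then obtain p where k: "k = cls (ev p)" and "k \<noteq> \<zero>\<^bsub>quo\<^esub>"
      unfolding base_field_def by blast
    then have "\<not> r dvd p"
      by (simp add: cls_mem_zero_iff ev_mem_iff)
    then obtain p' where "r dvd p' * p - 1"
      using inv by blast
    then have "cls (ev p') \<otimes>\<^bsub>quo\<^esub> k = \<one>\<^bsub>quo\<^esub>"
      using ev_cong[of "p' * p" 1] by (simp add: k cls_mult cls_1 cls_eq_iff ev_mult)
    moreover have mem: "k \<in> base_field" "cls (ev p') \<in> base_field"
      by (simp_all add: k base_field_def)
    moreover have "k \<otimes>\<^bsub>quo\<^esub> cls (ev p') = \<one>\<^bsub>quo\<^esub>"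
      using comm[OF mem] calculation(1) by simp
    ultimately show "k \<in> Units (quo \<lparr>carrier := base_field\<rparr>)"
      by (auto simp: Units_def intro!: bexI[of _ "cls (ev p')"])
  qed
qed

text \<open>Row \<open>i\<close> of \<open>m\<close> holds the coordinates of \<open>x\<close> times
  the \<open>i\<close>-th basis element of \<open>L\<close>. Since \<open>x ^ n\<close> acts as
  \<open>a\<close>, comparing coordinates gives the twisted equation.\<close>

lemma left_ideal_twisted_root:
  assumes inv: "\<forall>p. \<not> r dvd p \<longrightarrow> (\<exists>p'. r dvd p' * p - 1)"
    and L: "subalgebra (carrier quo) L quo" and d: "Q.dimension d base_field L"
  shows "\<exists>m. twisted_root d m"
proof -
  note K = base_field_subfield[OF inv]
  obtain Us where Us: "set Us \<subseteq> range cls" "Q.independent base_field Us" "length Us = d"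
      "Q.Span base_field Us = L"
    using Q.exists_base[OF K d] by (auto simp: carrier_quo)
  obtain u where u: "Us = map (\<lambda>j. cls (u j)) [0..<d]"
    using list_range_conv_map_upt[OF Us(1,3)] by blast
  have Us_sub: "set Us \<subseteq> carrier quo"
    using Us(1) by (simp add: carrier_quo)
  have "\<exists>c. x * u i \<doteq> (\<Sum>j<d. ev (c j) * u j)" if "i < d" for i
  proof -
    have "cls (u i) \<in> L"
      using Q.Span_base_incl[OF K Us_sub] that unfolding Us(4) by (auto simp: u)
    then have "cls (x * u i) \<in> L"
      using Q.left_ideal_mult_closed[OF L cls_carrier, of "cls (u i)" x] by (simp add: cls_mult)
    then obtain Ks where Ks: "set Ks \<subseteq> base_field" "length Ks = d" "cls (x * u i) = Q.combine Ks Us"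
      using Q.Span_mem_iff_length_version[OF K Us_sub] Us(3,4) by auto
    obtain c where "Ks = map (\<lambda>j. cls (ev (c j))) [0..<d]"
      using list_range_conv_map_upt[OF Ks(1)[unfolded base_field_def] Ks(2)] by blast
    with Ks(3) show ?thesis
      by (auto simp: u combine_cls cls_eq_iff)
  qed
  then obtain m where m: "x * u i \<doteq> (\<Sum>j<d. ev (m i j) * u j)" if "i < d" for i
    by metis
  have x_pow: "x ^ k * u i \<doteq> (\<Sum>j<d. ev (poly_twisted_power q d m k i j) * u j)" if "i < d" for k i
    using that
  proof (induction k arbitrary: i)
    case 0
    have "(\<Sum>j<d. ev (poly_twisted_power q d m 0 i j) * u j) = (\<Sum>j<d. if i = j then u j else 0)"
      by (intro sum.cong) auto
    then show ?case
      using 0 by simp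
  next
    case (Suc k)
    let ?T = "poly_twisted_power q d m"
    have "x ^ Suc k * u i = x ^ k * (x * u i)"
      by (simp add: power_Suc2 mult.assoc del: power_Suc)
    also have "\<dots> \<doteq> x ^ k * (\<Sum>l<d. ev (m i l) * u l)"
      by (intro cong_mult cong_refl m Suc.prems)
    also have "\<dots> = (\<Sum>l<d. x ^ k * ev (m i l) * u l)"
      by (simp add: sum_distrib_left mult.assoc)
    also have "\<dots> \<doteq> (\<Sum>l<d. ev (scale_arg (q ^ k) (m i l)) * x ^ k * u l)"
      by (intro cong_sum cong_mult cong_refl x_pow_ev)
    also have "\<dots> = (\<Sum>l<d. ev (scale_arg (q ^ k) (m i l)) * (x ^ k * u l))"
      by (simp add: mult.assoc)
    also have "\<dots> \<doteq> (\<Sum>l<d. ev (scale_arg (q ^ k) (m i l)) * (\<Sum>j<d. ev (?T k l j) * u j))"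
      by (intro cong_sum cong_mult cong_refl Suc.IH) simp
    also have "\<dots> = (\<Sum>l<d. \<Sum>j<d. ev (scale_arg (q ^ k) (m i l) * ?T k l j) * u j)"
      by (simp add: sum_distrib_left ev_mult mult.assoc)
    also have "\<dots> = (\<Sum>j<d. \<Sum>l<d. ev (scale_arg (q ^ k) (m i l) * ?T k l j) * u j)"
      by (rule sum.swap)
    also have "\<dots> = (\<Sum>j<d. ev (?T (Suc k) i j) * u j)"
      by (simp add: ev_sum sum_distrib_right)
    finally show ?case .
  qed
  have "r dvd poly_twisted_power q d m n i j - (if i = j then [:a:] else 0)" if ij: "i < d" "j < d" for i j
  proof -
    \<comment> \<open>These are the coefficients of a relation between the basis elements, obtained
      from the two values of \<open>x ^ n * u i\<close>.\<close>
    define c where "c j = poly_twisted_power q d m n i j - (if i = j then [:a:] else 0)" for j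
    have "(\<Sum>j<d. ev (if i = j then [:a:] else 0) * u j) = (\<Sum>j<d. if i = j then free_scalar a * u j else 0)"
      by (intro sum.cong) (auto simp: ev_const)
    then have "(\<Sum>j<d. ev (c j) * u j)
        = (\<Sum>j<d. ev (poly_twisted_power q d m n i j) * u j) - free_scalar a * u i"
      using ij by (simp add: c_def ev_diff left_diff_distrib sum_subtractf)
    also have "\<dots> \<doteq> x ^ n * u i - free_scalar a * u i"
      by (intro cong_diff cong_refl cong_sym[OF x_pow] ij)
    also have "\<dots> \<doteq> free_scalar a * u i - free_scalar a * u i"
      by (intro cong_diff cong_mult cong_refl x_pow_n)
    finally have "cls (\<Sum>j<d. ev (c j) * u j) = \<zero>\<^bsub>quo\<^esub>"
      by (simp add: cls_0 cls_eq_iff)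
    then have "set (map (\<lambda>j. cls (ev (c j))) [0..<d]) \<subseteq> {\<zero>\<^bsub>quo\<^esub>}"
      using Q.independent_imp_trivial_combine[OF K Us(2), of "map (\<lambda>j. cls (ev (c j))) [0..<d]"] Us(3)
      by (auto simp: u combine_cls base_field_def)
    moreover have "cls (ev (c j)) \<in> set (map (\<lambda>j. cls (ev (c j))) [0..<d])"
      using ij by simp
    ultimately have "cls (ev (c j)) = \<zero>\<^bsub>quo\<^esub>"
      by blast
    then have "r dvd c j"
      by (simp add: cls_mem_zero_iff ev_mem_iff)
    then show ?thesis
      by (simp add: c_def)
  qed
  then show ?thesis
    unfolding twisted_root_def by blast
qed

lemma quo_dimension:
  assumes inv: "\<forall>p. \<not> r dvd p \<longrightarrow> (\<exists>p'. r dvd p' * p - 1)"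
  shows "Q.dimension n base_field (carrier quo)"
proof -
  note K = base_field_subfield[OF inv]
  let ?Us = "map (\<lambda>j. cls (x ^ j)) [0..<n]"
  have Us_sub: "set ?Us \<subseteq> carrier quo"
    by auto
  have "Q.independent base_field ?Us"
  proof (rule ccontr)
    assume "\<not> Q.independent base_field ?Us"
    then obtain Ks where "length Ks = length ?Us" and Ks: "Q.combine Ks ?Us = \<zero>\<^bsub>quo\<^esub>"
        "set Ks \<subseteq> base_field" "set Ks \<noteq> {\<zero>\<^bsub>quo\<^esub>}"
      by (rule Q.dependent_imp_non_trivial_combine[OF K Us_sub])
    then have "length Ks = n"
      by simp
    obtain c where c: "Ks = map (\<lambda>j. cls (ev (c j))) [0..<n]"
      using list_range_conv_map_upt[OF Ks(2)[unfolded base_field_def] \<open>length Ks = n\<close>] by blast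
    have "cls (ev (c j)) = \<zero>\<^bsub>quo\<^esub>" if "j < n" for j
      using independence[of c j] Ks(1) that by (simp add: c combine_cls cls_mem_zero_iff ev_mem_iff)
    then have "set Ks = {\<zero>\<^bsub>quo\<^esub>}"
      using n_pos by (auto simp: c image_iff)
    with Ks(3) show False
      by contradiction
  qed
  moreover have "Q.Span base_field ?Us = carrier quo"
  proof (intro subset_antisym subsetI)
    fix w assume "w \<in> carrier quo"
    then obtain f where w: "w = cls f"
      by (rule carrier_quoE)
    obtain c where "f \<doteq> (\<Sum>j<n. ev (c j) * x ^ j)"
      using spanning by blast
    then have "w = Q.combine (map (\<lambda>j. cls (ev (c j))) [0..<n]) ?Us"
      by (simp add: w combine_cls cls_eq_iff)
    moreover have "set (map (\<lambda>j. cls (ev (c j))) [0..<n]) \<subseteq> base_field"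
      by (auto simp: base_field_def)
    ultimately show "w \<in> Q.Span base_field ?Us"
      unfolding Q.Span_eq_combine_set[OF K Us_sub] by blast
  qed (use Q.Span_in_carrier[OF _ Us_sub] subfieldE(3)[OF K] in blast)
  ultimately show ?thesis
    using Q.dimensionI[OF K, of ?Us] by simp
qed

text \<open>
  Commutators with \<open>h\<close> scale the coefficient of \<open>x^j\<close> by \<open>q^j - q^i\<close>, so that \<open>n - 1\<close> of them
  isolate a single term of an element of a two-sided ideal, and this term is a unit.
\<close>

lemma two_sided_ideal_trivial:
  assumes inv: "\<forall>p. \<not> r dvd p \<longrightarrow> (\<exists>p'. r dvd p' * p - 1)"
    and "s \<noteq> 0" "a \<noteq> 0"
    and T: "ideal T ring_of_type_algebra" "J \<subseteq> T" and f: "f \<in> T" "f \<notin> J"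
  shows "1 \<in> T"
proof -
  interpret T: type_ideal T
    using T(1) by (simp add: type_ideal_def)
  have T_cong: "g' \<in> T" if "g \<in> T" "g \<doteq> g'" for g g'
    using that T(2) T.cong_mem[of g g'] by (auto simp: cong_mod_def T.cong_mod_def)
  obtain c where c: "f \<doteq> (\<Sum>j<n. ev (c j) * x ^ j)"
    using spanning by blast
  obtain t where t: "t < n" "\<not> r dvd c t"
  proof (rule ccontr)
    assume "\<not> thesis"
    then have "ev (c j) \<in> J" if "j < n" for j
      using that \<open>\<And>t. \<lbrakk>t < n; \<not> r dvd c t\<rbrakk> \<Longrightarrow> thesis\<close> ev_mem by blast
    then have "(\<Sum>j<n. ev (c j) * x ^ j) \<doteq> (\<Sum>j<n. 0 * x ^ j)"
      by (intro cong_sum cong_mult cong_refl) (simp add: cong_0_iff)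
    with c f(2) show False
      using cong_mem cong_0_iff by (auto dest: cong_trans)
  qed
  \<comment> \<open>The scalar that the coefficient of \<open>x ^ j\<close> has acquired after
    commutators for all \<open>i\<close> in \<open>S\<close>; it vanishes for \<open>j\<close> in
    \<open>S\<close>.\<close>
  define e where "e S j = (\<Prod>i\<in>S. q ^ j - q ^ i)" for S j
  have "(\<Sum>j<n. ev (smult (e S j) (c j * [:0, 1:] ^ card S)) * x ^ j) \<in> T" if "finite S" for S
    using that
  proof (induction S)
    case empty
    then show ?case
      using T_cong[OF f(1) c] by (simp add: e_def)
  next
    case (insert i S)
    define b where "b j = smult (e S j) (c j * [:0, 1:] ^ card S)" for j
    let ?u = "\<Sum>j<n. ev (b j) * x ^ j"
    have "?u \<in> T"
      using insert.IH by (simp add: b_def)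
    \<comment> \<open>The \<open>q ^ i\<close>-twisted commutator with \<open>h\<close> multiplies
      the coefficient of \<open>x ^ j\<close> by \<open>(q ^ j - q ^ i) X\<close> and removes the
      term \<open>j = i\<close>.\<close>
    then have "?u * h - (free_scalar (q ^ i) * h) * ?u \<in> T"
      by (intro T.diff_mem T.mult_right_mem T.mult_left_mem)
    moreover have "?u * h - (free_scalar (q ^ i) * h) * ?u
        \<doteq> (\<Sum>j<n. ev (smult (e (insert i S) j) (c j * [:0, 1:] ^ card (insert i S))) * x ^ j)"
    proof -
      have "?u * h = (\<Sum>j<n. ev (b j) * (x ^ j * ev [:0, 1:]))"
        by (simp add: sum_distrib_right mult.assoc ev_X)
      also have "\<dots> \<doteq> (\<Sum>j<n. ev (b j) * (ev (scale_arg (q ^ j) [:0, 1:]) * x ^ j))"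
        by (intro cong_sum cong_mult cong_refl x_pow_ev)
      also have "\<dots> = (\<Sum>j<n. ev (smult (q ^ j) ([:0, 1:] * b j)) * x ^ j)"
      proof (intro sum.cong refl)
        fix j
        have "scale_arg (q ^ j) [:0, 1:] = smult (q ^ j) [:0, 1:]"
          by (simp add: scale_arg_pCons)
        then have "b j * scale_arg (q ^ j) [:0, 1:] = smult (q ^ j) ([:0, 1:] * b j)"
          by (simp only: mult_smult_right mult.commute)
        then show "ev (b j) * (ev (scale_arg (q ^ j) [:0, 1:]) * x ^ j) = ev (smult (q ^ j) ([:0, 1:] * b j)) * x ^ j"
          by (simp only: mult.assoc[symmetric] ev_mult[symmetric])
      qed
      finally have "?u * h \<doteq> (\<Sum>j<n. ev (smult (q ^ j) ([:0, 1:] * b j)) * x ^ j)" .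
      moreover have "(free_scalar (q ^ i) * h) * ?u = (\<Sum>j<n. ev (smult (q ^ i) ([:0, 1:] * b j)) * x ^ j)"
        by (simp only: sum_distrib_left ev_smult ev_mult ev_X mult.assoc)
      ultimately have "?u * h - (free_scalar (q ^ i) * h) * ?u
          \<doteq> (\<Sum>j<n. ev (smult (q ^ j) ([:0, 1:] * b j)) * x ^ j)
             - (\<Sum>j<n. ev (smult (q ^ i) ([:0, 1:] * b j)) * x ^ j)"
        by (intro cong_diff) simp_all
      also have "\<dots> = (\<Sum>j<n. ev (smult (q ^ j - q ^ i) ([:0, 1:] * b j)) * x ^ j)"
        by (simp only: sum_subtractf[symmetric] left_diff_distrib[symmetric] ev_diff[symmetric] smult_diff_left[symmetric])
      also have "\<dots> = (\<Sum>j<n. ev (smult (e (insert i S) j) (c j * [:0, 1:] ^ card (insert i S))) * x ^ j)"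
        using insert.hyps by (intro sum.cong) (simp_all add: e_def b_def ac_simps)
      finally show ?thesis .
    qed
    ultimately show ?case
      by (rule T_cong)
  qed
  from this[of "{..<n} - {t}"] have "(\<Sum>j<n. ev (smult (e ({..<n} - {t}) j) (c j * [:0, 1:] ^ (n - 1))) * x ^ j) \<in> T"
    using t(1) by simp
  also have "(\<Sum>j<n. ev (smult (e ({..<n} - {t}) j) (c j * [:0, 1:] ^ (n - 1))) * x ^ j)
      = (\<Sum>j<n. if j = t then ev (smult (e ({..<n} - {t}) j) (c j * [:0, 1:] ^ (n - 1))) * x ^ j else 0)"
  proof (intro sum.cong refl)
    fix j assume j: "j \<in> {..<n}"
    have "e ({..<n} - {t}) j = 0" if "j \<noteq> t"
      unfolding e_def using that j by (intro prod_zero) auto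
    then show "ev (smult (e ({..<n} - {t}) j) (c j * [:0, 1:] ^ (n - 1))) * x ^ j
        = (if j = t then ev (smult (e ({..<n} - {t}) j) (c j * [:0, 1:] ^ (n - 1))) * x ^ j else 0)"
      by auto
  qed
  also have "\<dots> = ev (smult (e ({..<n} - {t}) t) (c t * [:0, 1:] ^ (n - 1))) * x ^ t"
    using t(1) by simp
  finally have mem: "ev (smult (e ({..<n} - {t}) t) (c t * [:0, 1:] ^ (n - 1))) * x ^ t \<in> T" .
  define \<epsilon> where "\<epsilon> = e ({..<n} - {t}) t"
  have "\<epsilon> \<noteq> 0"
    unfolding \<epsilon>_def e_def using t(1) q_pow_inj[OF t(1)] by (auto simp: prod_zero_iff)
  obtain p' where p': "r dvd p' * c t - 1"
    using inv t(2) by blast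
  \<comment> \<open>\<open>X\<close> times \<open>Y\<close> is \<open>s\<close> modulo
    \<open>r\<close>, and \<open>s\<close> is nonzero, so \<open>Y\<close> is a unit of
    E(s).\<close>
  define Y :: "'a poly" where "Y = [:0, 1:] ^ (n - 1)"
  have X_n: "[:0, 1:] * Y = r + [:s:]"
    using n_pos by (simp only: Y_def r_def monom_altdef smult_1_left diff_add_cancel flip: power_Suc) simp
  \<comment> \<open>An inverse modulo \<open>r\<close> of the surviving coefficient:
    \<open>p'\<close> inverts \<open>c t\<close>, and \<open>X / s\<close> inverts
    \<open>Y\<close>.\<close>
  define p where "p = smult (inverse (\<epsilon> * s)) ([:0, 1:] * p')"
  have "p * smult \<epsilon> (c t * Y) = smult (inverse (\<epsilon> * s) * \<epsilon>) (p' * c t * ([:0, 1:] * Y))"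
    by (simp only: p_def mult_smult_left mult_smult_right smult_smult ac_simps)
  also have "inverse (\<epsilon> * s) * \<epsilon> = inverse s"
    using \<open>\<epsilon> \<noteq> 0\<close> \<open>s \<noteq> 0\<close> by (simp add: field_simps)
  finally have "p * smult \<epsilon> (c t * Y) = smult (inverse s) (p' * c t * (r + [:s:]))"
    unfolding X_n .
  also have "\<dots> = smult (inverse s) (p' * c t) * r + p' * c t"
    using \<open>s \<noteq> 0\<close> by (simp add: algebra_simps smult_add_right)
  finally have "p * smult \<epsilon> (c t * Y) - 1 = smult (inverse s) (p' * c t) * r + (p' * c t - 1)"
    by (simp only: add_diff_eq)
  moreover have "r dvd smult (inverse s) (p' * c t) * r + (p' * c t - 1)"
    using p' by (intro dvd_add dvd_triv_right)
  ultimately have "r dvd p * smult \<epsilon> (c t * Y) - 1"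
    by (simp only:)
  then have "ev p * ev (smult \<epsilon> (c t * Y)) \<doteq> 1"
    using ev_cong[of "p * smult \<epsilon> (c t * Y)" 1] by (simp only: ev_mult ev_1)
  \<comment> \<open>The remaining factor \<open>x ^ t\<close> is cancelled on the right by
    \<open>x ^ (n - t)\<close> and the inverse of \<open>a\<close>.\<close>
  then have *: "ev p * (ev (smult \<epsilon> (c t * Y)) * x ^ t) * (x ^ (n - t) * free_scalar (inverse a))
      \<doteq> 1 * (x ^ t * (x ^ (n - t) * free_scalar (inverse a)))"
    unfolding mult.assoc[symmetric] by (intro cong_mult cong_refl)
  have "x ^ t * (x ^ (n - t) * free_scalar (inverse a)) = x ^ n * free_scalar (inverse a)"
    using t(1) by (simp flip: mult.assoc power_add)
  also have "\<dots> \<doteq> free_scalar a * free_scalar (inverse a)"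
    by (intro cong_mult cong_refl x_pow_n)
  also have "\<dots> = 1"
    using \<open>a \<noteq> 0\<close> by (simp flip: free_scalar_simps)
  finally show ?thesis
    using T_cong[OF T.mult_right_mem[OF T.mult_left_mem[OF mem[folded \<epsilon>_def Y_def]]] *]
    by (auto intro: T_cong)
qed

text \<open>The algebra is simple of dimension \<open>n\<close>, so an element without left inverse
  yields a left ideal whose dimension is a proper divisor \<open>d\<close> of \<open>n\<close>, and
  thus a twisted root that \<open>size\<close> forbids.\<close>

lemma division_if:
  assumes inv: "\<forall>p. \<not> r dvd p \<longrightarrow> (\<exists>p'. r dvd p' * p - 1)"
    and "s \<noteq> 0" "a \<noteq> 0"
    and size: "\<And>d m. 0 < d \<Longrightarrow> d dvd n \<Longrightarrow> twisted_root d m \<Longrightarrow> n \<le> d"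
    and f: "f \<notin> J"
  shows "\<exists>g. g * f \<doteq> 1"
proof (rule ccontr)
  assume no_inv: "\<nexists>g. g * f \<doteq> 1"
  note K = base_field_subfield[OF inv]
  have simple: "I = carrier quo" if I: "ideal I quo" "I \<noteq> {\<zero>\<^bsub>quo\<^esub>}" for I
  proof -
    interpret I: ideal I quo by (rule I(1))
    \<comment> \<open>Pulling the ideal back to the free algebra reduces simplicity to
      \<open>two_sided_ideal_trivial\<close>.\<close>
    define T where "T = {f. cls f \<in> I}"
    have "ideal T ring_of_type_algebra"
    proof (rule ideal_ring_of_type_algebraI)
      show "0 \<in> T"
        using I.zero_closed by (simp add: T_def cls_0)
      show "f + g \<in> T" if "f \<in> T" "g \<in> T" for f g
        using I.a_closed that by (simp add: T_def cls_add[symmetric])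
      show "g * f \<in> T" "f * g \<in> T" if "f \<in> T" for f g
        using I.I_l_closed I.I_r_closed that by (simp_all add: T_def cls_mult[symmetric])
    qed
    moreover have "J \<subseteq> T"
      using I.zero_closed by (auto simp: T_def simp flip: cls_mem_zero_iff)
    moreover obtain f where "f \<in> T" "f \<notin> J"
    proof -
      obtain w where w: "w \<in> I" "w \<noteq> \<zero>\<^bsub>quo\<^esub>"
        using I(2) I.zero_closed by blast
      then obtain f where "w = cls f"
        using I.a_subset carrier_quoE by blast
      with w that show thesis
        by (simp add: T_def cls_mem_zero_iff)
    qed
    ultimately have "1 \<in> T"
      using two_sided_ideal_trivial[OF inv \<open>s \<noteq> 0\<close> \<open>a \<noteq> 0\<close>] by blast
    then show ?thesis
      using I.one_imp_carrier by (simp add: T_def cls_1)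
  qed
  obtain L d where L: "subalgebra (carrier quo) L quo" "Q.dimension d base_field L"
    and d: "1 \<le> d" "d < n" "d dvd n"
  proof (rule Q.simple_ring_left_ideal_dimension_dvd[OF K quo_dimension[OF inv] simple, of "cls f"])
    show "cls f \<noteq> \<zero>\<^bsub>quo\<^esub>"
      using f by (simp add: cls_mem_zero_iff)
    show "w \<otimes>\<^bsub>quo\<^esub> cls f \<noteq> \<one>\<^bsub>quo\<^esub>" if "w \<in> carrier quo" for w
      using that no_inv by (elim carrier_quoE) (simp add: cls_mult cls_1 cls_eq_iff)
  qed auto
  obtain m where "twisted_root d m"
    using left_ideal_twisted_root[OF inv L] by blast
  then show False
    using size[of d m] d by simp
qed

end

section \<open>Matrices over the radical extension\<close>

lemma radical_ideal_eq: "radical_ideal n c = {p. Polynomial.monom 1 n - [:c:] dvd p}"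
  by (auto simp: radical_ideal_def cgenideal_def dvd_def mult.commute)

lemma ideal_radical_ideal: "ideal (radical_ideal n c) ring_of_type_algebra"
  by (rule ideal_ring_of_type_algebraI) (auto simp: radical_ideal_eq)

lemma cring_radical_alg: "cring (radical_alg n c)"
  unfolding radical_alg_def
  by (rule ideal.quotient_is_cring[OF ideal_radical_ideal cring_from_type_algebra])

lemma primitive_nth_root_inverse: "primitive_nth_root n q \<Longrightarrow> primitive_nth_root n (inverse q)"
  by (simp add: primitive_nth_root_def power_inverse)

section \<open>Translation between E(s) and polynomials modulo \<open>r\<close>\<close>

context symbol_presentation
begin

sublocale E: type_ideal "radical_ideal n s"
  unfolding type_ideal_def by (rule ideal_radical_ideal)

lemma radical_class_eq: "radical_class n s = E.cls"
  by (simp add: fun_eq_iff radical_class_def E.cls_def)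

lemma radical_alg_eq: "radical_alg n s = E.quo"
  by (simp add: radical_alg_def)

lemma E_cong_iff: "E.cong_mod p p' \<longleftrightarrow> r dvd p - p'"
  unfolding E.cong_mod_def by (simp add: radical_ideal_eq r_def)

lemma field_radical_alg_iff:
  "field (radical_alg n s) \<longleftrightarrow> (\<forall>p. \<not> r dvd p \<longrightarrow> (\<exists>p'. r dvd p' * p - 1))"
proof -
  have "field (radical_alg n s) \<longleftrightarrow> is_division_ring (radical_alg n s)"
    by (rule cring.field_iff_is_division_ring[OF cring_radical_alg])
  also have "\<dots> \<longleftrightarrow> 1 \<notin> radical_ideal n s \<and>
      (\<forall>p. p \<notin> radical_ideal n s \<longrightarrow> (\<exists>p'. E.cong_mod (p' * p) 1))"
    unfolding radical_alg_eq by (rule E.is_division_ring_quo_iff)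
  finally show ?thesis
    using not_r_dvd_1 unfolding E_cong_iff by (simp add: radical_ideal_eq flip: r_def)
qed

context
  fixes \<sigma> :: "'a poly set \<Rightarrow> 'a poly set"
  assumes aut: "radical_automorphism n s \<sigma>"
    and gen: "\<sigma> (radical_gen n s) = radical_scalar n s q \<otimes>\<^bsub>radical_alg n s\<^esub> radical_gen n s"
begin

text \<open>An automorphism is determined by its values on scalars and on the generator; the
  induction follows Horner's scheme.\<close>

lemma automorphism_cls: "\<sigma> (E.cls p) = E.cls (scale_arg q p)"
proof -
  have hom: "\<sigma> \<in> Ring.ring_hom E.quo E.quo" and scalar: "\<sigma> (E.cls [:u:]) = E.cls [:u:]" for u
    using aut by (auto simp: radical_automorphism_def ring_iso_def radical_alg_eq radical_class_eq)
  have gen': "\<sigma> (E.cls [:0, 1:]) = E.cls [:0, q:]"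
    using gen by (simp add: radical_alg_eq radical_class_eq E.cls_mult)
  show ?thesis
  proof (induction p)
    case 0
    show ?case
      using scalar[of 0] by simp
  next
    case (pCons c p)
    have closed: "E.cls [:0, 1:] \<otimes>\<^bsub>E.quo\<^esub> E.cls p \<in> carrier E.quo"
      by (simp only: E.cls_mult E.cls_carrier)
    have "pCons c p = [:c:] + [:0, 1:] * p"
      by simp
    then have "\<sigma> (E.cls (pCons c p))
        = \<sigma> (E.cls [:c:] \<oplus>\<^bsub>E.quo\<^esub> (E.cls [:0, 1:] \<otimes>\<^bsub>E.quo\<^esub> E.cls p))"
      by (simp only: E.cls_add E.cls_mult)
    also have "\<dots> = \<sigma> (E.cls [:c:]) \<oplus>\<^bsub>E.quo\<^esub> (\<sigma> (E.cls [:0, 1:]) \<otimes>\<^bsub>E.quo\<^esub> \<sigma> (E.cls p))"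
      by (simp only: closed ring_hom_add[OF hom] ring_hom_mult[OF hom] E.cls_carrier)
    also have "\<dots> = E.cls ([:c:] + [:0, q:] * scale_arg q p)"
      by (simp only: scalar gen' pCons.IH E.cls_add E.cls_mult)
    finally show ?case
      by (simp add: scale_arg_pCons)
  qed
qed

lemma automorphism_pow_cls: "(\<sigma> ^^ k) (E.cls p) = E.cls (scale_arg (q ^ k) p)"
  by (induction k) (simp_all add: automorphism_cls scale_arg_scale_arg)

lemma twisted_power_cls:
  "twisted_power E.quo d \<sigma> (mat d d (\<lambda>(i, j). E.cls (m i j))) k
    = mat d d (\<lambda>(i, j). E.cls (poly_twisted_power q d m k i j))"
proof (induction k)
  case 0
  show ?case
    by (rule eq_matI) (simp_all add: scalar_matrix_def E.cls_0 E.cls_1)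
next
  case (Suc k)
  interpret EQ: ring E.quo
    by (rule E.quotient_is_ring)
  let ?T = "poly_twisted_power q d m"
  show ?case
  proof (rule eq_matI)
    fix i j
    assume "i < dim_row (mat d d (\<lambda>(i, j). E.cls (?T (Suc k) i j)))"
      and "j < dim_col (mat d d (\<lambda>(i, j). E.cls (?T (Suc k) i j)))"
    then have ij: "i < d" "j < d"
      by simp_all
    let ?A = "map_mat (\<sigma> ^^ k) (mat d d (\<lambda>(i, j). E.cls (m i j)))"
    let ?B = "mat d d (\<lambda>(i, j). E.cls (?T k i j))"
    have "(\<Oplus>\<^bsub>E.quo\<^esub>l\<in>{..<d}. ?A $$ (i, l) \<otimes>\<^bsub>E.quo\<^esub> ?B $$ (l, j))
        = (\<Oplus>\<^bsub>E.quo\<^esub>l\<in>{..<d}. E.cls (scale_arg (q ^ k) (m i l) * ?T k l j))"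
      by (intro EQ.finsum_cong') (simp_all add: ij automorphism_pow_cls E.cls_mult)
    also have "\<dots> = E.cls (?T (Suc k) i j)"
      by (simp add: E.cls_sum)
    finally show "twisted_power E.quo d \<sigma> (mat d d (\<lambda>(i, j). E.cls (m i j))) (Suc k) $$ (i, j)
        = mat d d (\<lambda>(i, j). E.cls (?T (Suc k) i j)) $$ (i, j)"
      using ij by (simp add: Suc.IH matrix_mult_def)
  qed (simp_all add: Suc.IH matrix_mult_def)
qed

lemma ring_matrices_cls:
  "ring_matrices E.quo d = range (\<lambda>m. mat d d (\<lambda>(i, j). E.cls (m i j)))"
proof (intro subset_antisym subsetI)
  fix M assume "M \<in> ring_matrices E.quo d"
  then have M: "M \<in> carrier_mat d d" "elements_mat M \<subseteq> range E.cls"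
    by (auto simp: ring_matrices_def E.carrier_quo)
  have "\<exists>p. M $$ (i, j) = E.cls p" if "i < d" "j < d" for i j
  proof -
    have "M $$ (i, j) \<in> elements_mat M"
      by (rule elements_matI[OF M(1) that refl])
    with M(2) show ?thesis
      by blast
  qed
  then obtain m where "M $$ (i, j) = E.cls (m i j)" if "i < d" "j < d" for i j
    by metis
  then have "M = mat d d (\<lambda>(i, j). E.cls (m i j))"
    using M(1) by (intro eq_matI) auto
  then show "M \<in> range (\<lambda>m. mat d d (\<lambda>(i, j). E.cls (m i j)))"
    by blast
qed (auto simp: ring_matrices_def elements_mat_def)

text \<open>Choosing polynomial representatives of the entries turns the equation over the quotient
  ring into \<open>twisted_root\<close>.\<close>

lemma twisted_root_iff:
  "(\<exists>M\<in>ring_matrices (radical_alg n s) d. twisted_power (radical_alg n s) d \<sigma> M n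
      = scalar_matrix (radical_alg n s) d (radical_scalar n s a))
    \<longleftrightarrow> (\<exists>m. twisted_root d m)"
proof -
  have "mat d d (\<lambda>(i, j). E.cls (poly_twisted_power q d m n i j)) = scalar_matrix E.quo d (E.cls [:a:])
      \<longleftrightarrow> twisted_root d m" for m
  proof -
    have "scalar_matrix E.quo d (E.cls [:a:]) = mat d d (\<lambda>(i, j). E.cls (if i = j then [:a:] else 0))"
      by (rule eq_matI) (simp_all add: scalar_matrix_def E.cls_0)
    then show ?thesis
      by (simp add: mat_eq_iff twisted_root_def E.cls_eq_iff E_cong_iff)
  qed
  then show ?thesis
    unfolding radical_alg_eq radical_class_eq ring_matrices_cls by (simp add: twisted_power_cls)
qed

lemma is_division_ring_iff:
  assumes "s \<noteq> 0" "a \<noteq> 0"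
  shows "is_division_ring quo \<longleftrightarrow>
    field (radical_alg n s) \<and>
    n = Min {d. 1 \<le> d \<and> d dvd n \<and>
      (\<exists>M\<in>ring_matrices (radical_alg n s) d. twisted_power (radical_alg n s) d \<sigma> M n
        = scalar_matrix (radical_alg n s) d (radical_scalar n s a))}"
proof -
  define D where "D = {d. 1 \<le> d \<and> d dvd n \<and> (\<exists>m. twisted_root d m)}"
  have "finite D"
    unfolding D_def using n_pos by (rule finite_subset[rotated, OF finite_divisors_nat]) auto
  \<comment> \<open>The companion matrix makes the set nonempty, so \<open>Min\<close> is meaningful
    and equals \<open>n\<close> exactly when \<open>n\<close> is a lower bound.\<close>
  moreover have "n \<in> D"
    unfolding D_def using n_pos companion_twisted_root by auto
  ultimately have Min: "n = Min D \<longleftrightarrow> (\<forall>d\<in>D. n \<le> d)"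
    by (metis Min_eqI Min_le)
  have "is_division_ring quo \<longleftrightarrow> (\<forall>f. f \<notin> J \<longrightarrow> (\<exists>g. g * f \<doteq> 1))"
    using is_division_ring_quo_iff one_notin_J by blast
  also have "\<dots> \<longleftrightarrow> (\<forall>p. \<not> r dvd p \<longrightarrow> (\<exists>p'. r dvd p' * p - 1)) \<and> (\<forall>d\<in>D. n \<le> d)"
    (is "?div \<longleftrightarrow> ?field \<and> ?min")
  proof
    assume div: ?div
    have ?field
      using field_if_division[OF div] by blast
    moreover have ?min
      using twisted_root_size_if_division[OF div] unfolding D_def by auto
    ultimately show "?field \<and> ?min" ..
  next
    assume *: "?field \<and> ?min"
    have size: "n \<le> d" if "0 < d" "d dvd n" "twisted_root d m" for d m
    proof -
      have "d \<in> D"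
        unfolding D_def using that by auto
      with * show ?thesis
        by blast
    qed
    show ?div
      by (intro allI impI) (rule division_if[OF conjunct1[OF *] assms size])
  qed
  finally show ?thesis
    unfolding field_radical_alg_iff twisted_root_iff D_def[symmetric] Min .
qed

end

section \<open>Exchanging the two generators\<close>

lemma hx: "h * x \<doteq> free_scalar (inverse q) * x * h"
proof -
  have "h * x = free_scalar (inverse q) * (free_scalar q * h * x)"
    using q_nonzero by (simp add: mult.assoc[symmetric] free_scalar_simps(4)[symmetric] free_scalar_simps(2))
  also have "\<dots> \<doteq> free_scalar (inverse q) * (x * h)"
    by (intro cong_mult cong_refl cong_sym[OF xh])
  finally show ?thesis
    by (simp add: mult.assoc)
qed

lemma symbol_alg_eq:
  assumes "gh = Gen_h" "gx = Gen_x"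
  shows "symbol_alg n q s a = quo"
  unfolding symbol_alg_def symbol_relations_def J_def relations_def h_def x_def Let_def
  unfolding assms ..

text \<open>The relations of one presentation follow from those of the other, where
  \<open>hx\<close> accounts for the commutation rule. Used in both directions, this gives equality
  of the two ideals.\<close>

lemma J_subset_swapped:
  assumes "symbol_presentation n (inverse q) gx gh"
  shows "J \<subseteq> symbol_presentation.J n (inverse q) a s gx gh"
proof -
  interpret S: symbol_presentation n "inverse q" a s gx gh
    by (rule assms)
  have "S.h = x" "S.x = h"
    by (simp_all add: S.h_def S.x_def h_def x_def)
  then have "relations \<subseteq> S.J"
    using S.hx S.h_pow_n S.x_pow_n by (simp add: relations_def S.cong_mod_def)
  then show ?thesis
    unfolding J_def by (rule ring.genideal_minimal[OF ring_ring_of_type_algebra S.ideal_axioms])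
qed

end

theorem corollary2p21:
  fixes n :: nat and q s a :: "'a::field"
    and \<sigma> \<tau> :: "'a poly set \<Rightarrow> 'a poly set"
  assumes "n \<ge> 2"
    and "primitive_nth_root n q"
    and "radical_automorphism n s \<sigma>"
    and "\<sigma> (radical_gen n s) = radical_scalar n s q \<otimes>\<^bsub>radical_alg n s\<^esub> radical_gen n s"
    and "radical_automorphism n a \<tau>"
    and "\<tau> (radical_gen n a) = radical_scalar n a (inverse q) \<otimes>\<^bsub>radical_alg n a\<^esub> radical_gen n a"
    and "s \<noteq> 0" and "a \<noteq> 0"
  shows
    "(is_division_ring (symbol_alg n q s a) \<longleftrightarrow>
       field (radical_alg n s) \<and>
       n = Min {d. 1 \<le> d \<and> d dvd n \<and>
         (\<exists>M \<in> ring_matrices (radical_alg n s) d.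
            twisted_power (radical_alg n s) d \<sigma> M n =
            scalar_matrix (radical_alg n s) d (radical_scalar n s a))}) \<and>
     (is_division_ring (symbol_alg n q s a) \<longleftrightarrow>
       field (radical_alg n a) \<and>
       n = Min {d. 1 \<le> d \<and> d dvd n \<and>
         (\<exists>N \<in> ring_matrices (radical_alg n a) d.
            twisted_power (radical_alg n a) d \<tau> N n =
            scalar_matrix (radical_alg n a) d (radical_scalar n a s))})"
proof -
  interpret S: symbol_presentation n q s a Gen_h Gen_x
    using assms by unfold_locales auto
  \<comment> \<open>Here \<open>x\<close> plays the part of \<open>h\<close>. The base algebra is
    E(a), and \<open>inverse q\<close> is the factor by which \<open>\<tau>\<close> scales its
    generator.\<close>
  interpret T: symbol_presentation n "inverse q" a s Gen_x Gen_h
    using assms primitive_nth_root_inverse by unfold_locales auto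
  \<comment> \<open>Both presentations live in the same free algebra, so equal ideals give the same
    quotient and the second equivalence concerns the same algebra as the first.\<close>
  have "S.J = T.J"
    using S.J_subset_swapped[OF T.symbol_presentation_axioms] T.J_subset_swapped S.symbol_presentation_axioms
    by simp
  then show ?thesis
    unfolding S.symbol_alg_eq[OF refl refl]
    using S.is_division_ring_iff[OF assms(3,4,7,8)] T.is_division_ring_iff[OF assms(5,6,8,7)] by simp
qed

end
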